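(* Let $(M,g)$, $M=T\times Q\times\mathbb{R}$, be a generalized gravitational wave spacetime (see context), with projection $\pi:M\to E=T\times Q$, Lagrangian $L$, Hamiltonian $H$, and $n=\partial_y$. (1) Let $e=(t,q)\in E$, $w\in T_eE$ with $dt[w]=1$, so that $w=\partial_t+v$ with $v\in T_qQ$, and let $x\in\pi^{-1}(e)$. Then there is one and only one lightlike vector $w^L\in T_xM$ such that $\pi_*(w^L)=w$. This vector is future directed and is given by $$w^L=\partial_t+v+L(t,q,v)\,n .$$ (2) Let $N_t=\{t\}\times Q\times\mathbb{R}\subset M$ be a slice of constant time, $x=(t,q,y)\in N_t$, and let $\omega\in T^*_xN_t$ satisfy $\omega(n)=1$, so that $\omega=dy-p$ with $p\in T_q^*Q$. Then there is one and only one lightlike 1-form $\omega^L\in T^*_xM$ (i.e. $\omega^L\neq 0$, $g^{-1}(\omega^L,\omega^L)=0$) whose pullback to $N_t$ under the inclusion $N_t\hookrightarrow M$ coincides with $\omega$. It is given by $$\omega^L=dy-p+H(t,q,p)\,dt .$$ (3) The minus musical isomorphism, restricted to lightlike vectors and lightlike 1-forms of these types, acts as the Legendre transformation on the components: $$-g\big(\cdot,\ \partial_t+v+L(t,q,v)\,n\big)=dy-p+H(t,q,p)\,dt\quad\text{with } p=\frac{\partial L}{\partial v}=a_t(\cdot,v)+b_t,$$ $$-g^{-1}\big(\cdot,\ dy-p+H(t,q,p)\,dt\big)=\partial_t+v+L(t,q,v)\,n\quad\text{with } v=\frac{\partial H}{\partial p}=a_t^{-1}(\cdot,p-b_t).$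$
   Context: Setting. $r\ge 2$; $Q$ is a connected $d$-dimensional ($C^{r+1}$, Hausdorff, paracompact, boundaryless) manifold; $T\subset\mathbb{R}$ is a connected interval, open because spacetimes are without boundary; $E=T\times Q$ with points $e=(t,q)$. On $Q$ there are given a time-dependent Riemannian (positive definite) metric $a_t$, a time-dependent 1-form $b_t$ and a function $V(t,q)$, all $C^r$ in $(t,q)\in E$. The Lagrangian is $L(t,q,v)=\frac12 a_t(v,v)+b_t(v)-V(t,q)$, $v\in T_qQ$, and the Hamiltonian is $H(t,q,p)=\frac12 a_t^{-1}(p-b_t,p-b_t)+V(t,q)$, $p\in T^*_qQ$. The generalized gravitational wave spacetime is $M=T\times Q\times\mathbb{R}$ with points $(t,q,y)$ and Lorentzian metric (signature $(-,+,\dots,+)$) $$g=a_t-dt\otimes(dy-b_t)-(dy-b_t)\otimes dt-2V\,dt^2,$$ time oriented by the timelike vector field $W=\partial_t-(V-\tfrac12)\partial_y$. The vector field $n=\partial_y$ is lightlike, future directed and covariantly constant. $\pi:M\to E$ is $(t,q,y)\mapsto(t,q)$. Lightlike vectors are by convention nonzero. $g^{-1}$ is the contravariant metric. *)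

theory Defs
  imports "HOL-Analysis.Analysis" "HOL-Library.Function_Algebras"
begin

text \<open>Pointwise vector space structure on functions.  Tangent vectors and covectors are both
  encoded as functions below, so they are added and scaled with \<open>+\<close> and \<open>*\<^sub>R\<close>.\<close>

instantiation "fun" :: (type, real_vector) real_vector
begin
definition scaleR_fun_def: "c *\<^sub>R f = (\<lambda>x. c *\<^sub>R f x)"
instance
  by standard (simp_all add: scaleR_fun_def fun_eq_iff scaleR_add_right scaleR_add_left)
end

lemma scaleR_fun_apply [simp]: "(c *\<^sub>R f) x = c *\<^sub>R f x"
  by (simp add: scaleR_fun_def)


section \<open>Manifolds of finite differentiability class\<close>

text \<open>The \<open>C\<^sup>k\<close> maps on an open set.  All domains used are open subsets of finite dimensional
  spaces, where continuity of all directional derivatives up to order \<open>k\<close> is the usual notion.\<close>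

primrec Ck_on ::
  "nat \<Rightarrow> ('a::real_normed_vector \<Rightarrow> 'b::real_normed_vector) \<Rightarrow> 'a set \<Rightarrow> bool" where
  "Ck_on 0 f S \<longleftrightarrow> continuous_on S f"
| "Ck_on (Suc k) f S \<longleftrightarrow>
     (\<forall>x\<in>S. f differentiable (at x)) \<and> (\<forall>u. Ck_on k (\<lambda>x. frechet_derivative f (at x) u) S)"

text \<open>A chart is a pair of its domain and a coordinate map; the values of the coordinate map
  outside the domain are irrelevant.\<close>

type_synonym ('p, 'e) chart = "'p set \<times> ('p \<Rightarrow> 'e)"

definition chart_inv :: "('p, 'e) chart \<Rightarrow> 'e \<Rightarrow> 'p" where
  "chart_inv c = inv_into (fst c) (snd c)"

definition chart_on :: "'p topology \<Rightarrow> ('p, 'e::real_normed_vector) chart \<Rightarrow> bool" where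
  "chart_on X c \<longleftrightarrow> openin X (fst c) \<and> open (snd c ` fst c) \<and>
     homeomorphic_map (subtopology X (fst c)) (top_of_set (snd c ` fst c)) (snd c)"

definition paracompact_space :: "'p topology \<Rightarrow> bool" where
  "paracompact_space X \<longleftrightarrow>
     (\<forall>\<U>. (\<forall>U\<in>\<U>. openin X U) \<and> \<Union>\<U> = topspace X \<longrightarrow>
       (\<exists>\<V>. (\<forall>V\<in>\<V>. openin X V) \<and> \<Union>\<V> = topspace X \<and>
            (\<forall>V\<in>\<V>. \<exists>U\<in>\<U>. V \<subseteq> U) \<and> locally_finite_in X \<V>))"

text \<open>The model space is a real normed space of dimension \<open>d\<close>, i.e. \<open>\<real>\<^sup>d\<close> up to a linear
  homeomorphism; the class \<open>euclidean_space\<close> would exclude \<open>d = 0\<close>.\<close>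

definition Ck_manifold ::
  "nat \<Rightarrow> nat \<Rightarrow> 'p topology \<Rightarrow> ('p, 'e::real_normed_vector) chart set \<Rightarrow> bool" where
  "Ck_manifold k d X A \<longleftrightarrow>
     Hausdorff_space X \<and> paracompact_space X \<and>
     (\<exists>B::'e set. finite B \<and> card B = d \<and> independent B \<and> span B = UNIV) \<and>
     (\<forall>c\<in>A. chart_on X c) \<and> (\<Union>c\<in>A. fst c) = topspace X \<and>
     (\<forall>c\<in>A. \<forall>c'\<in>A. Ck_on k (snd c' \<circ> chart_inv c) (snd c ` (fst c \<inter> fst c')))"

definition charts_at :: "('p, 'e) chart set \<Rightarrow> 'p \<Rightarrow> ('p, 'e) chart set" where
  "charts_at A x = {c \<in> A. x \<in> fst c}"


section \<open>Tangent and cotangent spaces\<close>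

text \<open>A tangent vector at \<open>x\<close> is the family of its components in the charts around \<open>x\<close>,
  related by the derivatives of the transition maps; by convention the component is \<open>0\<close> in
  every other chart.\<close>

type_synonym ('p, 'e) tvec = "('p, 'e) chart \<Rightarrow> 'e"

definition tangent_space ::
  "('p, 'e::real_normed_vector) chart set \<Rightarrow> 'p \<Rightarrow> ('p, 'e) tvec set" where
  "tangent_space A x = {X.
     (\<forall>c. c \<notin> charts_at A x \<longrightarrow> X c = 0) \<and>
     (\<forall>c\<in>charts_at A x. \<forall>c'\<in>charts_at A x.
        X c' = frechet_derivative (snd c' \<circ> chart_inv c) (at (snd c x)) (X c))}"

text \<open>The tangent vector at \<open>x\<close> with component \<open>u\<close> in the chart \<open>c\<close>.\<close>

definition coord_vec ::
  "('p, 'e::real_normed_vector) chart set \<Rightarrow> ('p, 'e) chart \<Rightarrow> 'p \<Rightarrow> 'e \<Rightarrow> ('p, 'e) tvec" where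
  "coord_vec A c x u = (\<lambda>c'. if c' \<in> charts_at A x
     then frechet_derivative (snd c' \<circ> chart_inv c) (at (snd c x)) u else 0)"

definition velocity ::
  "('p, 'e::real_normed_vector) chart set \<Rightarrow> (real \<Rightarrow> 'p) \<Rightarrow> real \<Rightarrow> ('p, 'e) tvec" where
  "velocity A \<gamma> s = (\<lambda>c. if c \<in> charts_at A (\<gamma> s)
     then vector_derivative (snd c \<circ> \<gamma>) (at s) else 0)"

text \<open>The differential at \<open>x\<close> of a map \<open>F\<close> between manifolds, computed in some chart around
  \<open>x\<close> (the choice is immaterial by the chain rule) and set to \<open>0\<close> off the tangent space.\<close>

definition dmap ::
  "('p, 'e::real_normed_vector) chart set \<Rightarrow> ('r, 'f::real_normed_vector) chart set \<Rightarrow>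
   ('p \<Rightarrow> 'r) \<Rightarrow> 'p \<Rightarrow> ('p, 'e) tvec \<Rightarrow> ('r, 'f) tvec" where
  "dmap A B F x X = (\<lambda>c'. if X \<in> tangent_space A x \<and> c' \<in> charts_at B (F x)
     then let c = (SOME c. c \<in> charts_at A x)
          in frechet_derivative (snd c' \<circ> F \<circ> chart_inv c) (at (snd c x)) (X c)
     else 0)"

definition dfun ::
  "('p, 'e::real_normed_vector) chart set \<Rightarrow> ('p \<Rightarrow> real) \<Rightarrow> 'p \<Rightarrow> ('p, 'e) tvec \<Rightarrow> real" where
  "dfun A f x X = (if X \<in> tangent_space A x
     then let c = (SOME c. c \<in> charts_at A x)
          in frechet_derivative (f \<circ> chart_inv c) (at (snd c x)) (X c)
     else 0)"

text \<open>The dual of a linear subspace \<open>S\<close>: linear forms on \<open>S\<close>, extended by \<open>0\<close> off \<open>S\<close> so that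
  equality of functions is equality of forms.\<close>

definition dual_space :: "'v::real_vector set \<Rightarrow> ('v \<Rightarrow> real) set" where
  "dual_space S = {\<omega>.
     (\<forall>X\<in>S. \<forall>Y\<in>S. \<omega> (X + Y) = \<omega> X + \<omega> Y) \<and>
     (\<forall>c. \<forall>X\<in>S. \<omega> (c *\<^sub>R X) = c * \<omega> X) \<and>
     (\<forall>X. X \<notin> S \<longrightarrow> \<omega> X = 0)}"

definition pullback ::
  "('p, 'e::real_normed_vector) chart set \<Rightarrow> ('r, 'f::real_normed_vector) chart set \<Rightarrow>
   ('p \<Rightarrow> 'r) \<Rightarrow> 'p \<Rightarrow> (('r, 'f) tvec \<Rightarrow> real) \<Rightarrow> ('p, 'e) tvec \<Rightarrow> real" where
  "pullback A B F x \<omega> = (\<lambda>X. \<omega> (dmap A B F x X))"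

text \<open>Inner products on \<open>S\<close>, likewise extended by \<open>0\<close>.\<close>

definition inner_product_on :: "'v::real_vector set \<Rightarrow> ('v \<Rightarrow> 'v \<Rightarrow> real) \<Rightarrow> bool" where
  "inner_product_on S B \<longleftrightarrow>
     (\<forall>X\<in>S. B X \<in> dual_space S) \<and> (\<forall>X. X \<notin> S \<longrightarrow> B X = 0) \<and>
     (\<forall>X Y. B X Y = B Y X) \<and> (\<forall>X\<in>S. X \<noteq> 0 \<longrightarrow> B X X > 0)"

text \<open>For a nondegenerate symmetric bilinear form \<open>B\<close> on a finite dimensional \<open>S\<close>: the musical
  isomorphism from the dual of \<open>S\<close> to \<open>S\<close> and the induced (contravariant) form on the dual.\<close>

definition sharp :: "'v::real_vector set \<Rightarrow> ('v \<Rightarrow> 'v \<Rightarrow> real) \<Rightarrow> ('v \<Rightarrow> real) \<Rightarrow> 'v" where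
  "sharp S B \<omega> = (THE X. X \<in> S \<and> (\<forall>Y\<in>S. B Y X = \<omega> Y))"

definition inverse_form ::
  "'v::real_vector set \<Rightarrow> ('v \<Rightarrow> 'v \<Rightarrow> real) \<Rightarrow> ('v \<Rightarrow> real) \<Rightarrow> ('v \<Rightarrow> real) \<Rightarrow> real" where
  "inverse_form S B \<omega> \<eta> = B (sharp S B \<omega>) (sharp S B \<eta>)"

text \<open>\<open>v = \<Phi>\<close> under the canonical identification of \<open>S\<close> with its bidual.\<close>

definition bidual_eq :: "'v::real_vector set \<Rightarrow> (('v \<Rightarrow> real) \<Rightarrow> real) \<Rightarrow> 'v \<Rightarrow> bool" where
  "bidual_eq S \<Phi> v \<longleftrightarrow> v \<in> S \<and> (\<forall>\<sigma>\<in>dual_space S. \<sigma> v = \<Phi> \<sigma>)"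

text \<open>\<open>D\<close> is the derivative at \<open>x\<close> of the function \<open>f\<close> on the vector space \<open>S\<close> (a fibre of the
  tangent or cotangent bundle); this is how \<open>\<partial>L/\<partial>v\<close> and \<open>\<partial>H/\<partial>p\<close> are read.\<close>

definition fibre_derivative ::
  "'v::real_vector set \<Rightarrow> ('v \<Rightarrow> real) \<Rightarrow> 'v \<Rightarrow> ('v \<Rightarrow> real) \<Rightarrow> bool" where
  "fibre_derivative S f x D \<longleftrightarrow>
     (\<forall>u\<in>S. ((\<lambda>s. f (x + s *\<^sub>R u)) has_real_derivative D u) (at 0))"


section \<open>Product manifolds\<close>

definition prod_atlas ::
  "('p, 'e) chart set \<Rightarrow> ('r, 'f) chart set \<Rightarrow> ('p \<times> 'r, 'e \<times> 'f) chart set" where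
  "prod_atlas A B = {(fst c \<times> fst c', map_prod (snd c) (snd c')) | c c'. c \<in> A \<and> c' \<in> B}"


section \<open>Generalized gravitational wave spacetimes\<close>

text \<open>The components are \<open>T\<close>, the topology and the atlas of \<open>Q\<close>, and the fields \<open>a\<close>, \<open>b\<close>, \<open>V\<close>
  as functions of \<open>t\<close> and \<open>q\<close>.\<close>

record ('q, 'e) ggw =
  T_of :: "real set"
  Q_top :: "'q topology"
  Q_atlas :: "('q, 'e) chart set"
  a_of :: "real \<Rightarrow> 'q \<Rightarrow> ('q, 'e) tvec \<Rightarrow> ('q, 'e) tvec \<Rightarrow> real"
  b_of :: "real \<Rightarrow> 'q \<Rightarrow> ('q, 'e) tvec \<Rightarrow> real"
  V_of :: "real \<Rightarrow> 'q \<Rightarrow> real"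

abbreviation TQ :: "('q, 'e::real_normed_vector, 'z) ggw_scheme \<Rightarrow> 'q \<Rightarrow> ('q, 'e) tvec set" where
  "TQ G q \<equiv> tangent_space (Q_atlas G) q"

definition ggw_spacetime ::
  "nat \<Rightarrow> nat \<Rightarrow> ('q, 'e::real_normed_vector) ggw \<Rightarrow> bool" where
  "ggw_spacetime r d G \<longleftrightarrow>
     open (T_of G) \<and> is_interval (T_of G) \<and>
     Ck_manifold (r + 1) d (Q_top G) (Q_atlas G) \<and> connected_space (Q_top G) \<and>
     (\<forall>t\<in>T_of G. \<forall>q\<in>topspace (Q_top G).
        inner_product_on (TQ G q) (a_of G t q) \<and> b_of G t q \<in> dual_space (TQ G q)) \<and>
     (\<forall>c\<in>Q_atlas G.
        (\<forall>u w. Ck_on r (\<lambda>(t, z). a_of G t (chart_inv c z)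
                   (coord_vec (Q_atlas G) c (chart_inv c z) u)
                   (coord_vec (Q_atlas G) c (chart_inv c z) w)) (T_of G \<times> snd c ` fst c)) \<and>
        (\<forall>u. Ck_on r (\<lambda>(t, z). b_of G t (chart_inv c z)
                   (coord_vec (Q_atlas G) c (chart_inv c z) u)) (T_of G \<times> snd c ` fst c)) \<and>
        Ck_on r (\<lambda>(t, z). V_of G t (chart_inv c z)) (T_of G \<times> snd c ` fst c))"

definition Lagrangian ::
  "('q, 'e::real_normed_vector) ggw \<Rightarrow> real \<Rightarrow> 'q \<Rightarrow> ('q, 'e) tvec \<Rightarrow> real" where
  "Lagrangian G t q v = 1/2 * a_of G t q v v + b_of G t q v - V_of G t q"

definition a_inv ::
  "('q, 'e::real_normed_vector) ggw \<Rightarrow> real \<Rightarrow> 'q \<Rightarrow>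
   (('q, 'e) tvec \<Rightarrow> real) \<Rightarrow> (('q, 'e) tvec \<Rightarrow> real) \<Rightarrow> real" where
  "a_inv G t q = inverse_form (TQ G q) (a_of G t q)"

definition Hamiltonian ::
  "('q, 'e::real_normed_vector) ggw \<Rightarrow> real \<Rightarrow> 'q \<Rightarrow> (('q, 'e) tvec \<Rightarrow> real) \<Rightarrow> real" where
  "Hamiltonian G t q p =
     1/2 * a_inv G t q (p - b_of G t q) (p - b_of G t q) + V_of G t q"


subsection \<open>The event space \<open>E = T \<times> Q\<close>\<close>

definition E_atlas ::
  "('q, 'e::real_normed_vector) ggw \<Rightarrow> (real \<times> 'q, real \<times> 'e) chart set" where
  "E_atlas G = prod_atlas {(T_of G, id)} (Q_atlas G)"

abbreviation TE ::
  "('q, 'e::real_normed_vector) ggw \<Rightarrow> real \<times> 'q \<Rightarrow> (real \<times> 'q, real \<times> 'e) tvec set" where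
  "TE G e \<equiv> tangent_space (E_atlas G) e"

definition del_t_E ::
  "('q, 'e::real_normed_vector) ggw \<Rightarrow> real \<times> 'q \<Rightarrow> (real \<times> 'q, real \<times> 'e) tvec" where
  "del_t_E G = (\<lambda>(t, q). velocity (E_atlas G) (\<lambda>s. (s, q)) t)"

definition dt_E ::
  "('q, 'e::real_normed_vector) ggw \<Rightarrow> real \<times> 'q \<Rightarrow> (real \<times> 'q, real \<times> 'e) tvec \<Rightarrow> real" where
  "dt_E G e = dfun (E_atlas G) fst e"

text \<open>\<open>v \<in> T\<^sub>qQ\<close> regarded as an element of \<open>T\<^sub>eE\<close>, \<open>e = (t,q)\<close>.\<close>

definition lift_E ::
  "('q, 'e::real_normed_vector) ggw \<Rightarrow> real \<times> 'q \<Rightarrow> ('q, 'e) tvec \<Rightarrow>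
   (real \<times> 'q, real \<times> 'e) tvec" where
  "lift_E G = (\<lambda>(t, q). dmap (Q_atlas G) (E_atlas G) (\<lambda>q'. (t, q')) q)"


subsection \<open>The spacetime \<open>M = T \<times> Q \<times> \<real>\<close>\<close>

definition M_atlas ::
  "('q, 'e::real_normed_vector) ggw \<Rightarrow> (real \<times> 'q \<times> real, real \<times> 'e \<times> real) chart set" where
  "M_atlas G = prod_atlas {(T_of G, id)} (prod_atlas (Q_atlas G) {(UNIV, id)})"

abbreviation TM ::
  "('q, 'e::real_normed_vector) ggw \<Rightarrow> real \<times> 'q \<times> real \<Rightarrow>
   (real \<times> 'q \<times> real, real \<times> 'e \<times> real) tvec set" where
  "TM G x \<equiv> tangent_space (M_atlas G) x"

definition del_t ::
  "('q, 'e::real_normed_vector) ggw \<Rightarrow> real \<times> 'q \<times> real \<Rightarrow>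
   (real \<times> 'q \<times> real, real \<times> 'e \<times> real) tvec" where
  "del_t G = (\<lambda>(t, q, y). velocity (M_atlas G) (\<lambda>s. (s, q, y)) t)"

definition n_vec ::
  "('q, 'e::real_normed_vector) ggw \<Rightarrow> real \<times> 'q \<times> real \<Rightarrow>
   (real \<times> 'q \<times> real, real \<times> 'e \<times> real) tvec" where
  "n_vec G = (\<lambda>(t, q, y). velocity (M_atlas G) (\<lambda>s. (t, q, s)) y)"

definition lift_M ::
  "('q, 'e::real_normed_vector) ggw \<Rightarrow> real \<times> 'q \<times> real \<Rightarrow> ('q, 'e) tvec \<Rightarrow>
   (real \<times> 'q \<times> real, real \<times> 'e \<times> real) tvec" where
  "lift_M G = (\<lambda>(t, q, y). dmap (Q_atlas G) (M_atlas G) (\<lambda>q'. (t, q', y)) q)"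

definition dt ::
  "('q, 'e::real_normed_vector) ggw \<Rightarrow> real \<times> 'q \<times> real \<Rightarrow>
   (real \<times> 'q \<times> real, real \<times> 'e \<times> real) tvec \<Rightarrow> real" where
  "dt G x = dfun (M_atlas G) (\<lambda>(t, q, y). t) x"

definition dy ::
  "('q, 'e::real_normed_vector) ggw \<Rightarrow> real \<times> 'q \<times> real \<Rightarrow>
   (real \<times> 'q \<times> real, real \<times> 'e \<times> real) tvec \<Rightarrow> real" where
  "dy G x = dfun (M_atlas G) (\<lambda>(t, q, y). y) x"

definition push_Q ::
  "('q, 'e::real_normed_vector) ggw \<Rightarrow> real \<times> 'q \<times> real \<Rightarrow>
   (real \<times> 'q \<times> real, real \<times> 'e \<times> real) tvec \<Rightarrow> ('q, 'e) tvec" where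
  "push_Q G x = dmap (M_atlas G) (Q_atlas G) (\<lambda>(t, q, y). q) x"

definition push_E ::
  "('q, 'e::real_normed_vector) ggw \<Rightarrow> real \<times> 'q \<times> real \<Rightarrow>
   (real \<times> 'q \<times> real, real \<times> 'e \<times> real) tvec \<Rightarrow> (real \<times> 'q, real \<times> 'e) tvec" where
  "push_E G x = dmap (M_atlas G) (E_atlas G) (\<lambda>(t, q, y). (t, q)) x"

text \<open>\<open>p \<in> T\<^sub>q\<^sup>*Q\<close> regarded as a covector on \<open>M\<close>, via the projection to \<open>Q\<close>.\<close>

definition pull_M ::
  "('q, 'e::real_normed_vector) ggw \<Rightarrow> real \<times> 'q \<times> real \<Rightarrow> (('q, 'e) tvec \<Rightarrow> real) \<Rightarrow>
   (real \<times> 'q \<times> real, real \<times> 'e \<times> real) tvec \<Rightarrow> real" where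
  "pull_M G x = pullback (M_atlas G) (Q_atlas G) (\<lambda>(t, q, y). q) x"

definition gmetric ::
  "('q, 'e::real_normed_vector) ggw \<Rightarrow> real \<times> 'q \<times> real \<Rightarrow>
   (real \<times> 'q \<times> real, real \<times> 'e \<times> real) tvec \<Rightarrow>
   (real \<times> 'q \<times> real, real \<times> 'e \<times> real) tvec \<Rightarrow> real" where
  "gmetric G = (\<lambda>(t, q, y) X Y. let x = (t, q, y); \<beta> = dy G x - pull_M G x (b_of G t q) in
     a_of G t q (push_Q G x X) (push_Q G x Y)
       - dt G x X * \<beta> Y - \<beta> X * dt G x Y - 2 * V_of G t q * dt G x X * dt G x Y)"

definition gmetric_inv ::
  "('q, 'e::real_normed_vector) ggw \<Rightarrow> real \<times> 'q \<times> real \<Rightarrow>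
   ((real \<times> 'q \<times> real, real \<times> 'e \<times> real) tvec \<Rightarrow> real) \<Rightarrow>
   ((real \<times> 'q \<times> real, real \<times> 'e \<times> real) tvec \<Rightarrow> real) \<Rightarrow> real" where
  "gmetric_inv G x = inverse_form (TM G x) (gmetric G x)"

definition time_orientation ::
  "('q, 'e::real_normed_vector) ggw \<Rightarrow> real \<times> 'q \<times> real \<Rightarrow>
   (real \<times> 'q \<times> real, real \<times> 'e \<times> real) tvec" where
  "time_orientation G = (\<lambda>(t, q, y).
     del_t G (t, q, y) - (V_of G t q - 1/2) *\<^sub>R n_vec G (t, q, y))"

definition lightlike ::
  "('q, 'e::real_normed_vector) ggw \<Rightarrow> real \<times> 'q \<times> real \<Rightarrow>
   (real \<times> 'q \<times> real, real \<times> 'e \<times> real) tvec \<Rightarrow> bool" where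
  "lightlike G x X \<longleftrightarrow> X \<in> TM G x \<and> X \<noteq> 0 \<and> gmetric G x X X = 0"

text \<open>Signature \<open>(-,+,\<dots>,+)\<close>: a causal vector is future directed iff its product with the
  timelike field defining the time orientation is negative.\<close>

definition future_directed ::
  "('q, 'e::real_normed_vector) ggw \<Rightarrow> real \<times> 'q \<times> real \<Rightarrow>
   (real \<times> 'q \<times> real, real \<times> 'e \<times> real) tvec \<Rightarrow> bool" where
  "future_directed G x X \<longleftrightarrow> X \<in> TM G x \<and> X \<noteq> 0 \<and> gmetric G x X X \<le> 0 \<and>
     gmetric G x X (time_orientation G x) < 0"

definition lightlike_form ::
  "('q, 'e::real_normed_vector) ggw \<Rightarrow> real \<times> 'q \<times> real \<Rightarrow>
   ((real \<times> 'q \<times> real, real \<times> 'e \<times> real) tvec \<Rightarrow> real) \<Rightarrow> bool" where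
  "lightlike_form G x \<omega> \<longleftrightarrow>
     \<omega> \<in> dual_space (TM G x) \<and> \<omega> \<noteq> 0 \<and> gmetric_inv G x \<omega> \<omega> = 0"


subsection \<open>The slices \<open>N\<^sub>t = {t} \<times> Q \<times> \<real>\<close>\<close>

text \<open>The points are points \<open>(t,q,y)\<close> of \<open>M\<close>, so the inclusion into \<open>M\<close> is the identity; the
  charts are those of \<open>Q \<times> \<real>\<close>.\<close>

definition N_atlas ::
  "('q, 'e::real_normed_vector) ggw \<Rightarrow> real \<Rightarrow> (real \<times> 'q \<times> real, 'e \<times> real) chart set" where
  "N_atlas G t = {({t} \<times> fst c, snd c \<circ> snd) | c. c \<in> prod_atlas (Q_atlas G) {(UNIV, id)}}"

abbreviation TN ::
  "('q, 'e::real_normed_vector) ggw \<Rightarrow> real \<Rightarrow> real \<times> 'q \<times> real \<Rightarrow>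
   (real \<times> 'q \<times> real, 'e \<times> real) tvec set" where
  "TN G t x \<equiv> tangent_space (N_atlas G t) x"

definition n_vec_N ::
  "('q, 'e::real_normed_vector) ggw \<Rightarrow> real \<times> 'q \<times> real \<Rightarrow>
   (real \<times> 'q \<times> real, 'e \<times> real) tvec" where
  "n_vec_N G = (\<lambda>(t, q, y). velocity (N_atlas G t) (\<lambda>s. (t, q, s)) y)"

definition dy_N ::
  "('q, 'e::real_normed_vector) ggw \<Rightarrow> real \<times> 'q \<times> real \<Rightarrow>
   (real \<times> 'q \<times> real, 'e \<times> real) tvec \<Rightarrow> real" where
  "dy_N G = (\<lambda>(t, q, y). dfun (N_atlas G t) (\<lambda>(t', q', y'). y') (t, q, y))"

definition pull_N ::
  "('q, 'e::real_normed_vector) ggw \<Rightarrow> real \<times> 'q \<times> real \<Rightarrow> (('q, 'e) tvec \<Rightarrow> real) \<Rightarrow>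
   (real \<times> 'q \<times> real, 'e \<times> real) tvec \<Rightarrow> real" where
  "pull_N G = (\<lambda>(t, q, y).
     pullback (N_atlas G t) (Q_atlas G) (\<lambda>(t', q', y'). q') (t, q, y))"

definition restrict_N ::
  "('q, 'e::real_normed_vector) ggw \<Rightarrow> real \<times> 'q \<times> real \<Rightarrow>
   ((real \<times> 'q \<times> real, real \<times> 'e \<times> real) tvec \<Rightarrow> real) \<Rightarrow>
   (real \<times> 'q \<times> real, 'e \<times> real) tvec \<Rightarrow> real" where
  "restrict_N G = (\<lambda>(t, q, y). pullback (N_atlas G t) (M_atlas G) (\<lambda>x. x) (t, q, y))"

end

theory Submission
  imports Defs
begin

text \<open>A tangent vector of \<open>M\<close> at \<open>(t, q, y)\<close> is a triple \<open>(\<tau>, v, \<sigma>)\<close> standing for \<open>\<tau> \<partial>\<^sub>t + v + \<sigma> n\<close>, and in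
  these terms
  \<open>g((\<tau>, v, \<sigma>), (\<tau>', v', \<sigma>')) = a(v, v') - \<tau> (\<sigma>' - b v') - (\<sigma> - b v) \<tau>' - 2 V \<tau> \<tau>'\<close>.
  The norm of \<open>(1, v, \<sigma>)\<close> is therefore \<open>2 (L - \<sigma>)\<close>.  With \<open>v = a\<^sup>-\<^sup>1(\<cdot>, p - b)\<close>, the vector dual to
  \<open>dy - p + h dt\<close> is \<open>-(1, v, h + b v - 2 V)\<close>, and the norm of this form is \<open>2 (H - h)\<close>; for \<open>h = H\<close>
  the last component is \<open>L\<close>, which is the Legendre transformation.\<close>

section \<open>Dual spaces and the musical isomorphism\<close>

text \<open>Both uniqueness claims rest on the norm being affine, not quadratic, in the one free
  coefficient: \<open>n\<close> is lightlike, and so is \<open>dt\<close>, whose dual vector is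
  \<open>-n\<close>. The normalizations \<open>dt[w] = 1\<close> and \<open>\<omega>(n) = 1\<close>
  give the slope -2, hence exactly one root. The labour lies in reaching triples at all. A tangent
  vector is a compatible family over all charts, differentials are taken in a chart picked by
  \<open>SOME\<close>, and \<open>E\<close>, \<open>M\<close> and the slices carry three different
  atlases. The passage is therefore proved once, for any extension of the charts of \<open>Q\<close>
  by flat coordinates. The other obstacle is that the contravariant metric is built on
  \<open>sharp\<close>, a definite description, so dual vectors must be shown to exist. As
  \<open>g\<close> is indefinite, this takes two layers: Riesz representation for the positive
  definite \<open>a\<close>, then an elimination of the flat components that reduces
  \<open>g\<close> to \<open>a\<close>. Forms and differentials are extended by 0 off the tangent
  space, so equalities of forms also have to be checked there.\<close>

lemma dual_spaceD:
  assumes "\<omega> \<in> dual_space S"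
  shows dual_add: "\<And>X Y. X \<in> S \<Longrightarrow> Y \<in> S \<Longrightarrow> \<omega> (X + Y) = \<omega> X + \<omega> Y"
    and dual_scale: "\<And>c X. X \<in> S \<Longrightarrow> \<omega> (c *\<^sub>R X) = c * \<omega> X"
    and dual_off: "\<And>X. X \<notin> S \<Longrightarrow> \<omega> X = 0"
  using assms by (auto simp: dual_space_def)

lemma dual_minus:
  assumes "\<omega> \<in> dual_space S" "X \<in> S"
  shows "\<omega> (- X) = - \<omega> X"
  using dual_scale[OF assms, of "-1"] by simp

text \<open>If 0 lies in \<open>S\<close>, scale it by 0; otherwise the value is 0 by the convention
  off \<open>S\<close>.\<close>

lemma dual_zero:
  assumes "\<omega> \<in> dual_space S"
  shows "\<omega> 0 = 0"
  using dual_scale[OF assms, of 0 0] dual_off[OF assms, of 0] by fastforce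

lemma dual_space_add: "\<omega> \<in> dual_space S \<Longrightarrow> \<eta> \<in> dual_space S \<Longrightarrow> \<omega> + \<eta> \<in> dual_space S"
  by (auto simp: dual_space_def algebra_simps)

lemma dual_space_scale: "\<omega> \<in> dual_space S \<Longrightarrow> c *\<^sub>R \<omega> \<in> dual_space S"
  by (auto simp: dual_space_def algebra_simps)

lemma dual_space_diff: "\<omega> \<in> dual_space S \<Longrightarrow> \<eta> \<in> dual_space S \<Longrightarrow> \<omega> - \<eta> \<in> dual_space S"
  by (auto simp: dual_space_def algebra_simps)

lemma dual_eqI:
  assumes "\<omega> \<in> dual_space S" "\<eta> \<in> dual_space S" "\<And>X. X \<in> S \<Longrightarrow> \<omega> X = \<eta> X"
  shows "\<omega> = \<eta>"
proof
  fix X show "\<omega> X = \<eta> X"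
    using assms(3)[of X] dual_off[OF assms(1), of X] dual_off[OF assms(2), of X] by (cases "X \<in> S") auto
qed

text \<open>Nondegeneracy enters as a hypothesis about the one candidate \<open>X\<close>, so that
  the rule serves both the positive definite \<open>a\<close> and the indefinite
  \<open>g\<close>.\<close>

lemma sharp_eqI:
  assumes "X \<in> S" "\<And>Y. Y \<in> S \<Longrightarrow> B Y X = \<omega> Y"
    and "\<And>X'. X' \<in> S \<Longrightarrow> (\<And>Y. Y \<in> S \<Longrightarrow> B Y X' = B Y X) \<Longrightarrow> X' = X"
  shows "sharp S B \<omega> = X"
  unfolding sharp_def
proof (rule the_equality)
  show "X \<in> S \<and> (\<forall>Y\<in>S. B Y X = \<omega> Y)" using assms(1,2) by blast
  fix X' assume "X' \<in> S \<and> (\<forall>Y\<in>S. B Y X' = \<omega> Y)"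
  then show "X' = X" using assms(2,3) by metis
qed

section \<open>Riesz representation and quadratic functions on a finite-dimensional inner product
  space\<close>

locale inner_product_space =
  fixes S :: "'v::real_vector set" and B :: "'v \<Rightarrow> 'v \<Rightarrow> real"
  assumes subspace: "subspace S"
    and finite_span: "\<exists>F. finite F \<and> S = span F"
    and inner: "inner_product_on S B"
begin

text \<open>For \<open>X\<close> outside \<open>S\<close> the form \<open>B X\<close> is 0, again a
  linear form; so linearity in one argument can be used whatever the other one is.\<close>

lemma B_dual: "B X \<in> dual_space S"
proof (cases "X \<in> S")
  case False
  with inner have "B X = 0" by (auto simp: inner_product_on_def)
  then show ?thesis by (auto simp: dual_space_def)
qed (use inner in \<open>auto simp: inner_product_on_def\<close>)

lemma B_sym: "B X Y = B Y X"
  using inner by (auto simp: inner_product_on_def)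

lemma B_pos: "X \<in> S \<Longrightarrow> X \<noteq> 0 \<Longrightarrow> B X X > 0"
  using inner by (auto simp: inner_product_on_def)

lemma B_nonneg: "X \<in> S \<Longrightarrow> B X X \<ge> 0"
  using B_pos[of X] dual_zero[OF B_dual, of 0] by (cases "X = 0") auto

lemmas B_add_right = dual_add[OF B_dual]
  and B_scale_right = dual_scale[OF B_dual]
  and B_zero_right [simp] = dual_zero[OF B_dual]

lemma B_add_left: "X \<in> S \<Longrightarrow> Y \<in> S \<Longrightarrow> B (X + Y) Z = B X Z + B Y Z"
  using B_add_right[of X Y Z] by (simp add: B_sym)

lemma B_scale_left: "X \<in> S \<Longrightarrow> B (c *\<^sub>R X) Z = c * B X Z"
  using B_scale_right[of X Z c] by (simp add: B_sym)

lemma B_zero_left [simp]: "B 0 X = 0"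
  using B_zero_right[of X] by (simp add: B_sym)

lemma B_diff_left: "X \<in> S \<Longrightarrow> Y \<in> S \<Longrightarrow> B (X - Y) Z = B X Z - B Y Z"
  using B_add_left[of "X - Y" Y Z] subspace_diff[OF subspace] by simp

text \<open>Test the equality on \<open>Z = X - Y\<close>: the square of the difference would be
  both positive and 0.\<close>

lemma B_nondegenerate:
  assumes "X \<in> S" "Y \<in> S" "\<And>Z. Z \<in> S \<Longrightarrow> B Z X = B Z Y"
  shows "X = Y"
proof (rule ccontr)
  assume "X \<noteq> Y"
  then have "B (X - Y) (X - Y) > 0"
    using B_pos subspace_diff[OF subspace] assms by simp
  moreover have "B (X - Y) (X - Y) = B (X - Y) X - B (X - Y) Y"
    using B_diff_left[OF assms(1,2), of "X - Y"] B_sym[of X "X - Y"] B_sym[of Y "X - Y"]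
    by linarith
  moreover have "B (X - Y) X = B (X - Y) Y"
    using assms subspace_diff[OF subspace] by blast
  ultimately show False by simp
qed

lemma dual_separates:
  assumes "X \<in> S" "Y \<in> S" "\<And>\<sigma>. \<sigma> \<in> dual_space S \<Longrightarrow> \<sigma> X = \<sigma> Y"
  shows "X = Y"
  using assms B_dual by (intro B_nondegenerate) auto

text \<open>One Gram-Schmidt step per generator. \<open>\<omega>\<close> is kept arbitrary because
  the induction hypothesis is applied to two forms: \<open>\<omega>\<close> itself and
  \<open>B a\<close>.\<close>

lemma riesz_on_span:
  assumes "finite F" "F \<subseteq> S" "\<omega> \<in> dual_space S"
  shows "\<exists>X\<in>span F. \<forall>Y\<in>span F. B Y X = \<omega> Y"
  using assms
proof (induction F arbitrary: \<omega> rule: finite_induct)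
  case empty
  then show ?case using dual_zero by auto
next
  case (insert a F)
  have span_S: "span F \<subseteq> S"
    using insert.prems(1) span_minimal[OF _ subspace] by auto
  have a: "a \<in> S" using insert.prems by auto
  obtain X where X: "X \<in> span F" "\<And>Y. Y \<in> span F \<Longrightarrow> B Y X = \<omega> Y"
    using insert.IH[OF _ insert.prems(2)] insert.prems(1) by auto
  \<comment> \<open>Representing the form \<open>B a\<close> on \<open>span F\<close> yields the
    orthogonal projection \<open>a'\<close> of \<open>a\<close>, so \<open>e = a - a'\<close> is
    orthogonal to \<open>span F\<close>.\<close>
  obtain a' where a': "a' \<in> span F" "\<And>Y. Y \<in> span F \<Longrightarrow> B Y a' = B a Y"
    using insert.IH[OF _ B_dual[of a]] insert.prems(1) by auto
  define e where "e = a - a'"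
  have eS: "e \<in> S" unfolding e_def using a a' span_S subspace_diff[OF subspace] by auto
  have orth: "B e Y = 0" if "Y \<in> span F" for Y
    using that a' a span_S by (auto simp: e_def B_diff_left B_sym[of a' Y] subset_iff)
  \<comment> \<open>The multiple of \<open>e\<close> corrects the value on \<open>e\<close> and, by
    orthogonality, changes nothing on \<open>span F\<close>.\<close>
  define Z where "Z = X + (\<omega> e / B e e) *\<^sub>R e"
  have F_sub: "span F \<subseteq> span (insert a F)" by (intro span_mono) auto
  have e_span: "e \<in> span (insert a F)"
    unfolding e_def using F_sub a' by (intro span_diff) (auto intro: span_base)
  show ?case
  proof (intro bexI ballI)
    show "Z \<in> span (insert a F)"
      unfolding Z_def using X F_sub e_span by (intro span_add span_scale) auto
    fix Y assume "Y \<in> span (insert a F)"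
    then obtain k where k: "Y - k *\<^sub>R a \<in> span F" by (auto simp: span_insert)
    \<comment> \<open>Regroup \<open>Y\<close> along the orthogonal sum of \<open>span F\<close> and
      the line of \<open>e\<close>, instead of the line of \<open>a\<close>.\<close>
    define U where "U = Y - k *\<^sub>R a + k *\<^sub>R a'"
    have U: "U \<in> span F" unfolding U_def using k a' by (intro span_add span_scale) auto
    have Y: "Y = U + k *\<^sub>R e" by (simp add: U_def e_def algebra_simps)
    have US: "U \<in> S" and XS: "X \<in> S" using U X span_S by auto
    have ke: "k *\<^sub>R e \<in> S" and oe: "(\<omega> e / B e e) *\<^sub>R e \<in> S"
      using eS subspace_scale[OF subspace] by auto
    have "B U Z = \<omega> U"
      using X(2)[OF U] orth[OF U] XS oe eS
      by (simp add: Z_def B_add_right B_scale_right B_sym[of U e])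
    moreover have "B e Z = \<omega> e"
    \<comment> \<open>\<open>e = 0\<close> occurs when \<open>a\<close> already lies in
      \<open>span F\<close>; the equation on \<open>e\<close> then reads 0 = 0, whatever the
      quotient by \<open>B e e\<close> is.\<close>
    proof (cases "e = 0")
      case True
      then show ?thesis using dual_zero[OF insert.prems(2)] by simp
    next
      case False
      then have "B e e > 0" using B_pos eS by simp
      then show ?thesis using orth[OF X(1)] XS oe eS
        by (simp add: Z_def B_add_right B_scale_right)
    qed
    ultimately show "B Y Z = \<omega> Y"
      using US eS ke by (simp add: Y B_add_left B_scale_left dual_add[OF insert.prems(2)]
        dual_scale[OF insert.prems(2)])
  qed
qed

lemma sharp_props:
  assumes "\<omega> \<in> dual_space S"
  shows sharp_in: "sharp S B \<omega> \<in> S"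
    and B_sharp: "Y \<in> S \<Longrightarrow> B Y (sharp S B \<omega>) = \<omega> Y"
proof -
  obtain F where "finite F" "S = span F" using finite_span by blast
  then obtain X where X: "X \<in> S" "\<And>Y. Y \<in> S \<Longrightarrow> B Y X = \<omega> Y"
    using riesz_on_span[of F \<omega>] assms span_superset by blast
  have "sharp S B \<omega> = X"
  proof (rule sharp_eqI)
    fix X' assume "X' \<in> S" "\<And>Y. Y \<in> S \<Longrightarrow> B Y X' = B Y X"
    with X(1) show "X' = X" by (intro B_nondegenerate)
  qed (use X in blast)+
  with X show "sharp S B \<omega> \<in> S" "Y \<in> S \<Longrightarrow> B Y (sharp S B \<omega>) = \<omega> Y" by auto
qed

lemma inverse_form_eq:
  assumes "\<omega> \<in> dual_space S" "\<eta> \<in> dual_space S"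
  shows "inverse_form S B \<omega> \<eta> = \<omega> (sharp S B \<eta>)"
  using B_sharp[OF assms(1)] sharp_in[OF assms(2)]
  by (simp add: inverse_form_def B_sym[of "sharp S B \<omega>"])

lemma inverse_form_sym: "inverse_form S B \<omega> \<eta> = inverse_form S B \<eta> \<omega>"
  by (simp add: inverse_form_def B_sym)

text \<open>By \<open>inverse_form_eq\<close> the functional is evaluation at
  \<open>sharp S B \<eta>\<close>, and linear forms separate the points of \<open>S\<close>.\<close>

lemma bidual_eq_inverse_form:
  assumes "\<eta> \<in> dual_space S"
  shows "bidual_eq S (\<lambda>\<sigma>. inverse_form S B \<sigma> \<eta>) v \<longleftrightarrow> v = sharp S B \<eta>"
  using assms sharp_in[OF assms] dual_separates
  by (auto simp: bidual_eq_def inverse_form_eq)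

text \<open>Along each line the function is a polynomial of degree at most two in \<open>s\<close>;
  its derivative at 0 is the linear coefficient. Applied to the Lagrangian.\<close>

lemma fibre_derivative_quadratic:
  assumes "\<beta> \<in> dual_space S" "v \<in> S"
  shows "fibre_derivative S (\<lambda>v. 1/2 * B v v + \<beta> v - k) v (\<lambda>u. B u v + \<beta> u)"
  unfolding fibre_derivative_def
proof
  fix u assume u: "u \<in> S"
  have su: "s *\<^sub>R u \<in> S" for s using u subspace_scale[OF subspace] by simp
  have "(\<lambda>s. 1/2 * B (v + s *\<^sub>R u) (v + s *\<^sub>R u) + \<beta> (v + s *\<^sub>R u) - k)
    = (\<lambda>s. 1/2 * (B v v + 2 * s * B u v + s\<^sup>2 * B u u) + (\<beta> v + s * \<beta> u) - k)"
    using u su assms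
    by (simp add: fun_eq_iff B_add_left B_add_right B_scale_left B_scale_right B_sym[of v u]
        dual_add[OF assms(1)] dual_scale[OF assms(1)] power2_eq_square algebra_simps)
  moreover have "((\<lambda>s. 1/2 * (B v v + 2 * s * B u v + s\<^sup>2 * B u u) + (\<beta> v + s * \<beta> u) - k)
     has_real_derivative (B u v + \<beta> u)) (at 0)"
    by (auto intro!: derivative_eq_intros)
  ultimately show "((\<lambda>s. 1/2 * B (v + s *\<^sub>R u) (v + s *\<^sub>R u) + \<beta> (v + s *\<^sub>R u) - k)
     has_real_derivative (B u v + \<beta> u)) (at 0)" by simp
qed

text \<open>The same expansion on the dual space, where the linear coefficient
  \<open>inverse_form S B \<sigma> (p - \<beta>)\<close> is evaluation of \<open>\<sigma>\<close> at
  a vector. Applied to the Hamiltonian.\<close>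

lemma fibre_derivative_inverse_quadratic:
  assumes "p \<in> dual_space S" "\<beta> \<in> dual_space S"
  shows "fibre_derivative (dual_space S)
    (\<lambda>p. 1/2 * inverse_form S B (p - \<beta>) (p - \<beta>) + k) p (\<lambda>\<sigma>. \<sigma> (sharp S B (p - \<beta>)))"
  unfolding fibre_derivative_def
proof
  fix \<sigma> assume \<sigma>: "\<sigma> \<in> dual_space S"
  let ?I = "inverse_form S B" and ?P = "p - \<beta>"
  have P: "?P \<in> dual_space S" using assms dual_space_diff by blast
  have I: "?I (p + s *\<^sub>R \<sigma> - \<beta>) (p + s *\<^sub>R \<sigma> - \<beta>) = ?I ?P ?P + 2 * s * ?I \<sigma> ?P + s\<^sup>2 * ?I \<sigma> \<sigma>" for s
  proof -
    have eq: "p + s *\<^sub>R \<sigma> - \<beta> = ?P + s *\<^sub>R \<sigma>" by simp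
    have in_dual: "?P + s *\<^sub>R \<sigma> \<in> dual_space S" using P \<sigma> dual_space_add dual_space_scale by blast
    \<comment> \<open>With the second argument fixed, the inverse form is evaluation at a fixed
      vector, hence linear in the first; symmetry gives the second argument.\<close>
    have left: "?I (?P + s *\<^sub>R \<sigma>) \<theta> = ?I ?P \<theta> + s * ?I \<sigma> \<theta>" if "\<theta> \<in> dual_space S" for \<theta>
      using that in_dual P \<sigma> by (simp add: inverse_form_eq algebra_simps)
    show ?thesis
      unfolding eq left[OF in_dual]
      unfolding inverse_form_sym[of _ "?P + s *\<^sub>R \<sigma>"] left[OF P] left[OF \<sigma>]
      by (simp add: inverse_form_sym[of ?P \<sigma>] power2_eq_square algebra_simps)
  qed
  have "((\<lambda>s. 1/2 * (?I ?P ?P + 2 * s * ?I \<sigma> ?P + s\<^sup>2 * ?I \<sigma> \<sigma>) + k)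
     has_real_derivative ?I \<sigma> ?P) (at 0)"
    by (auto intro!: derivative_eq_intros)
  then show "((\<lambda>s. 1/2 * ?I (p + s *\<^sub>R \<sigma> - \<beta>) (p + s *\<^sub>R \<sigma> - \<beta>) + k)
     has_real_derivative \<sigma> (sharp S B ?P)) (at 0)"
    unfolding I by (simp add: inverse_form_eq[OF \<sigma> P])
qed

end

section \<open>Tangent vectors in charts\<close>

abbreviation transition_deriv ::
  "'p \<Rightarrow> ('p, 'e::real_normed_vector) chart \<Rightarrow> ('p, 'e) chart \<Rightarrow> 'e \<Rightarrow> 'e" where
  "transition_deriv x c c' \<equiv> frechet_derivative (snd c' \<circ> chart_inv c) (at (snd c x))"

lemma chart_inv_eq: "inj_on (snd c) (fst c) \<Longrightarrow> p \<in> fst c \<Longrightarrow> snd c p = z \<Longrightarrow> chart_inv c z = p"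
  unfolding chart_inv_def by (rule inv_into_f_eq)

text \<open>The chart chosen by \<open>SOME\<close> is unknown, so the derivative is required in
  every chart at \<open>x\<close>. That replaces a proof that the choice is immaterial.\<close>

lemma dmap_eqI:
  assumes "X \<in> tangent_space A x" "charts_at A x \<noteq> {}" "C \<in> charts_at B (F x)"
    and D: "\<And>c. c \<in> charts_at A x \<Longrightarrow>
      ((snd C \<circ> F \<circ> chart_inv c) has_derivative D c) (at (snd c x)) \<and> D c (X c) = Y"
  shows "dmap A B F x X C = Y"
proof -
  have "(SOME c. c \<in> charts_at A x) \<in> charts_at A x"
    using assms(2) by (auto intro: someI)
  from D[OF this] show ?thesis
    using assms(1,3) by (auto simp: dmap_def Let_def frechet_derivative_at[symmetric])
qed

lemma dfun_eqI:
  assumes "X \<in> tangent_space A x" "charts_at A x \<noteq> {}"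
    and D: "\<And>c. c \<in> charts_at A x \<Longrightarrow>
      ((f \<circ> chart_inv c) has_derivative D c) (at (snd c x)) \<and> D c (X c) = Y"
  shows "dfun A f x X = Y"
proof -
  have "(SOME c. c \<in> charts_at A x) \<in> charts_at A x"
    using assms(2) by (auto intro: someI)
  from D[OF this] show ?thesis
    using assms(1) by (auto simp: dfun_def Let_def frechet_derivative_at[symmetric])
qed

lemma dmap_off_tangent_space: "X \<notin> tangent_space A x \<Longrightarrow> dmap A B F x X = 0"
  by (auto simp: dmap_def fun_eq_iff)

lemma dmap_off_charts: "C \<notin> charts_at B (F x) \<Longrightarrow> dmap A B F x X C = 0"
  by (auto simp: dmap_def)

lemma dfun_off_tangent_space: "X \<notin> tangent_space A x \<Longrightarrow> dfun A f x X = 0"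
  by (auto simp: dfun_def)

lemma velocity_eqI:
  assumes "C \<in> charts_at A (\<gamma> s)" "((snd C \<circ> \<gamma>) has_vector_derivative u) (at s)"
  shows "velocity A \<gamma> s C = u"
  using assms by (simp add: velocity_def vector_derivative_at)

text \<open>The compatibility equation is turned around so that, as a rewrite rule, it removes
  transition derivatives instead of creating them.\<close>

lemma tangent_space_iff:
  "X \<in> tangent_space A x \<longleftrightarrow>
     (\<forall>c. c \<notin> charts_at A x \<longrightarrow> X c = 0) \<and>
     (\<forall>c\<in>charts_at A x. \<forall>c'\<in>charts_at A x. transition_deriv x c c' (X c) = X c')"
  by (simp add: tangent_space_def eq_commute[of "X _" "frechet_derivative _ _ _"])

lemma tangent_spaceI:
  assumes "\<And>c c'. c \<in> charts_at A x \<Longrightarrow> c' \<in> charts_at A x \<Longrightarrow> transition_deriv x c c' (X c) = X c'"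
    and "\<And>c. c \<notin> charts_at A x \<Longrightarrow> X c = 0"
  shows "X \<in> tangent_space A x"
  unfolding tangent_space_iff using assms by blast

lemma tangent_spaceD:
  assumes "X \<in> tangent_space A x"
  shows "c \<in> charts_at A x \<Longrightarrow> c' \<in> charts_at A x \<Longrightarrow> transition_deriv x c c' (X c) = X c'"
    and "c \<notin> charts_at A x \<Longrightarrow> X c = 0"
  using assms[unfolded tangent_space_iff] by blast+

section \<open>Transition derivatives and the tangent space at one point of an atlas\<close>

locale atlas_point =
  fixes A :: "('p, 'e::real_normed_vector) chart set" and q :: 'p
  assumes chart_inj: "c \<in> charts_at A q \<Longrightarrow> inj_on (snd c) (fst c)"
    and chart_open: "c \<in> charts_at A q \<Longrightarrow> c' \<in> charts_at A q \<Longrightarrow> open (snd c ` (fst c \<inter> fst c'))"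
    and transition_differentiable: "c \<in> charts_at A q \<Longrightarrow> c' \<in> charts_at A q \<Longrightarrow>
      (snd c' \<circ> chart_inv c) differentiable (at (snd c q))"
    and ex_chart: "charts_at A q \<noteq> {}"
begin

abbreviation "Ch \<equiv> charts_at A q"

lemma in_chart: "c \<in> Ch \<Longrightarrow> q \<in> fst c"
  by (simp add: charts_at_def)

lemma in_chart_image: "c \<in> Ch \<Longrightarrow> snd c q \<in> snd c ` fst c"
  by (simp add: in_chart)

lemma chart_range_open: "c \<in> Ch \<Longrightarrow> open (snd c ` fst c)"
  using chart_open[of c c] by simp

lemma chart_inv_chart: "c \<in> Ch \<Longrightarrow> p \<in> fst c \<Longrightarrow> chart_inv c (snd c p) = p"
  using chart_inj by (simp add: chart_inv_eq)

lemma transition_has_derivative: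
  assumes "c \<in> Ch" "c' \<in> Ch"
  shows "((snd c' \<circ> chart_inv c) has_derivative transition_deriv q c c') (at (snd c q))"
  using transition_differentiable[OF assms] frechet_derivative_works by blast

lemma transition_compose_has_derivative:
  assumes "c \<in> Ch" "c' \<in> Ch" "(g has_derivative g') (at x)" "g x = snd c q"
  shows "((\<lambda>x. snd c' (chart_inv c (g x))) has_derivative (\<lambda>h. transition_deriv q c c' (g' h))) (at x)"
  using diff_chain_at[OF assms(3), of "snd c' \<circ> chart_inv c"] transition_has_derivative[OF assms(1,2)]
    assms(4) by (simp add: comp_def)

lemma transition_linear: "c \<in> Ch \<Longrightarrow> c' \<in> Ch \<Longrightarrow> linear (transition_deriv q c c')"
  using transition_has_derivative has_derivative_linear by blast

lemma transition_cocycle: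
  assumes "c \<in> Ch" "c' \<in> Ch" "c'' \<in> Ch"
  shows "transition_deriv q c' c'' (transition_deriv q c c' u) = transition_deriv q c c'' u"
proof -
  have "((\<lambda>z. snd c'' (chart_inv c' (snd c' (chart_inv c z)))) has_derivative
      (\<lambda>h. transition_deriv q c' c'' (transition_deriv q c c' h))) (at (snd c q))"
    using transition_has_derivative[OF assms(1,2)] in_chart assms
    by (intro transition_compose_has_derivative) (auto simp: comp_def chart_inv_chart)
  then have "((snd c'' \<circ> chart_inv c) has_derivative
      (\<lambda>h. transition_deriv q c' c'' (transition_deriv q c c' h))) (at (snd c q))"
    by (rule has_derivative_transform_within_open[OF _ chart_open[OF assms(1,2)]])
      (use assms in_chart in \<open>auto simp: chart_inv_chart\<close>)
  then show ?thesis
    using frechet_derivative_at by metis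
qed

lemma subspace_tangent_space: "subspace (tangent_space A q)"
proof (rule subspaceI)
  show "0 \<in> tangent_space A q"
    by (rule tangent_spaceI) (simp_all add: transition_linear linear_0)
  fix X Y k assume "X \<in> tangent_space A q" "Y \<in> tangent_space A q"
  note D = tangent_spaceD[OF this(1)] tangent_spaceD[OF this(2)]
  show "X + Y \<in> tangent_space A q" "k *\<^sub>R X \<in> tangent_space A q"
    by (rule tangent_spaceI; simp add: D transition_linear linear_add linear_scale)+
qed

text \<open>One component determines a tangent vector by compatibility, and by the cocycle rule any
  value of it is attained. This carries finite dimension over from the model space.\<close>

lemma tangent_space_eq_range:
  assumes "c \<in> Ch"
  shows "tangent_space A q = range (coord_vec A c q)"
proof (intro equalityI subsetI)
  fix X assume "X \<in> tangent_space A q"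
  note D = tangent_spaceD[OF this]
  have "X = coord_vec A c q (X c)"
    by (intro ext) (simp add: coord_vec_def assms D)
  then show "X \<in> range (coord_vec A c q)" by blast
next
  fix X assume "X \<in> range (coord_vec A c q)"
  then obtain u where X: "X = coord_vec A c q u" by blast
  show "X \<in> tangent_space A q"
    by (rule tangent_spaceI) (simp_all add: X coord_vec_def assms transition_cocycle)
qed

lemma finite_span_tangent_space:
  assumes "finite F" "span F = (UNIV :: 'e set)"
  shows "\<exists>F. finite F \<and> tangent_space A q = span F"
proof -
  obtain c where c: "c \<in> Ch" using ex_chart by blast
  have "linear (coord_vec A c q)"
    by (rule linearI; rule ext)
      (simp_all add: coord_vec_def transition_linear c linear_add linear_scale)
  then have "span (coord_vec A c q ` F) = coord_vec A c q ` span F"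
    by (rule linear_span_image)
  with assms tangent_space_eq_range[OF c] show ?thesis
    by (metis finite_imageI)
qed

end

lemma chart_on_open_image:
  assumes "chart_on X c" "openin X U" "U \<subseteq> fst c"
  shows "open (snd c ` U)"
proof -
  from assms have "openin (subtopology X (fst c)) U"
    by (simp add: openin_open_subtopology chart_on_def)
  then have "openin (top_of_set (snd c ` fst c)) (snd c ` U)"
    using assms homeomorphic_imp_open_map unfolding chart_on_def open_map_def by blast
  then show ?thesis
    using assms by (auto simp: chart_on_def openin_open_eq)
qed

text \<open>Class \<open>Suc k\<close> gives differentiable transition maps; for a spacetime the
  class is \<open>r + 1\<close>.\<close>

lemma Ck_manifold_atlas_point:
  assumes M: "Ck_manifold (Suc k) d X A" and q: "q \<in> topspace X"
  shows "atlas_point A q"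
proof
  have ch: "chart_on X c" if "c \<in> charts_at A q" for c
    using that M by (auto simp: charts_at_def Ck_manifold_def)
  show "inj_on (snd c) (fst c)" if "c \<in> charts_at A q" for c
    using ch[OF that] homeomorphic_imp_injective_map[of _ _ "snd c"] openin_subset[of X "fst c"]
    by (fastforce simp: chart_on_def inf_absorb2 topspace_subtopology)
  show "open (snd c ` (fst c \<inter> fst c'))" if "c \<in> charts_at A q" "c' \<in> charts_at A q" for c c'
    using ch[OF that(1)] ch[OF that(2)]
    by (intro chart_on_open_image[of X]) (auto simp: chart_on_def)
  show "(snd c' \<circ> chart_inv c) differentiable (at (snd c q))"
    if "c \<in> charts_at A q" "c' \<in> charts_at A q" for c c'
  proof -
    have "Ck_on (Suc k) (snd c' \<circ> chart_inv c) (snd c ` (fst c \<inter> fst c'))"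
      using M that unfolding Ck_manifold_def charts_at_def by blast
    then show ?thesis
      using that by (auto simp: charts_at_def)
  qed
  show "charts_at A q \<noteq> {}"
  proof -
    have "q \<in> (\<Union>c\<in>A. fst c)" using M q unfolding Ck_manifold_def by blast
    then show ?thesis by (auto simp: charts_at_def)
  qed
qed

text \<open>The charts of \<open>T \<times> Q\<close>, \<open>T \<times> Q \<times> \<real>\<close> and \<open>{t} \<times> Q \<times> \<real>\<close> all arise from those of \<open>Q\<close> by adding
  flat coordinates: \<open>emb\<close> is the map of charts, and \<open>J w u\<close> is the coordinate vector with flat
  components \<open>w\<close> and \<open>Q\<close>-component \<open>u\<close>.\<close>

locale flat_extension = atlas_point A q
  for A :: "('p, 'e::real_normed_vector) chart set" and q :: 'p +
  fixes B :: "('r, 'f::real_normed_vector) chart set" and x :: 'r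
    and emb :: "('p, 'e) chart \<Rightarrow> ('r, 'f) chart"
    and J :: "'w::real_vector \<Rightarrow> 'e \<Rightarrow> 'f"
  assumes charts_at_eq: "charts_at B x = emb ` charts_at A q"
    and inj_emb: "inj_on emb (charts_at A q)"
    and linear_J: "linear (\<lambda>(w, u). J w u)"
    and bij_J: "bij (\<lambda>(w, u). J w u)"
    and transition_J: "c \<in> charts_at A q \<Longrightarrow> c' \<in> charts_at A q \<Longrightarrow>
      transition_deriv x (emb c) (emb c') (J w u) = J w (transition_deriv q c c' u)"
begin

definition ext_vec :: "'w \<Rightarrow> ('p, 'e) tvec \<Rightarrow> ('r, 'f) tvec" where
  "ext_vec w v = (\<lambda>C. if C \<in> charts_at B x then J w (v (inv_into Ch emb C)) else 0)"

lemma emb_chart: "c \<in> Ch \<Longrightarrow> emb c \<in> charts_at B x"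
  by (simp add: charts_at_eq)

lemma ex_chart_ext: "charts_at B x \<noteq> {}"
  using ex_chart by (simp add: charts_at_eq)

lemma vec_emb [simp]: "c \<in> Ch \<Longrightarrow> ext_vec w v (emb c) = J w (v c)"
  by (simp add: ext_vec_def inj_emb emb_chart)

lemma eq_vecI:
  assumes "\<And>c. c \<in> Ch \<Longrightarrow> X (emb c) = J w (v c)" "\<And>C. C \<notin> charts_at B x \<Longrightarrow> X C = 0"
  shows "X = ext_vec w v"
proof
  fix C show "X C = ext_vec w v C"
    using assms by (cases "C \<in> charts_at B x") (auto simp: charts_at_eq ext_vec_def inj_emb)
qed

lemma J_eq_iff: "J w u = J w' u' \<longleftrightarrow> w = w' \<and> u = u'"
  using bij_J by (auto simp: bij_def inj_def)

lemma J_add: "J w u + J w' u' = J (w + w') (u + u')"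
  using linear_add[OF linear_J, of "(w, u)" "(w', u')"] by simp

lemma J_scale: "k *\<^sub>R J w u = J (k *\<^sub>R w) (k *\<^sub>R u)"
  using linear_scale[OF linear_J, of k "(w, u)"] by simp

lemma J_zero: "J 0 0 = 0"
  using linear_0[OF linear_J] by (simp add: zero_prod_def)

lemma vec_add: "ext_vec w v + ext_vec w' v' = ext_vec (w + w') (v + v')"
  by (intro eq_vecI) (auto simp: J_add, auto simp: ext_vec_def)

lemma vec_scale: "k *\<^sub>R ext_vec w v = ext_vec (k *\<^sub>R w) (k *\<^sub>R v)"
  by (intro eq_vecI) (auto simp: J_scale, auto simp: ext_vec_def)

lemma vec_zero: "ext_vec 0 0 = 0"
  by (intro eq_vecI[symmetric]) (auto simp: J_zero)

text \<open>\<open>ext_vec\<close> only sees the components of \<open>v\<close> in charts around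
  \<open>q\<close>; membership in the tangent space makes the remaining ones 0 on both
  sides.\<close>

lemma vec_eq_iff:
  assumes "v \<in> tangent_space A q" "v' \<in> tangent_space A q"
  shows "ext_vec w v = ext_vec w' v' \<longleftrightarrow> w = w' \<and> v = v'"
proof
  assume eq: "ext_vec w v = ext_vec w' v'"
  have *: "w = w' \<and> v c = v' c" if "c \<in> Ch" for c
    using fun_cong[OF eq, of "emb c"] that by (simp add: J_eq_iff)
  then have "v = v'"
    using tangent_spaceD(2)[OF assms(1)] tangent_spaceD(2)[OF assms(2)] by (metis ext)
  with * ex_chart show "w = w' \<and> v = v'" by blast
qed simp

lemma vec_in_tangent_space:
  assumes "v \<in> tangent_space A q"
  shows "ext_vec w v \<in> tangent_space B x"
proof (rule tangent_spaceI)
  fix C C' assume "C \<in> charts_at B x" "C' \<in> charts_at B x"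
  then show "transition_deriv x C C' (ext_vec w v C) = ext_vec w v C'"
    using tangent_spaceD(1)[OF assms] by (auto simp: charts_at_eq transition_J)
qed (simp add: ext_vec_def)

text \<open>Split each component by the inverse of \<open>J\<close>. By \<open>transition_J\<close>
  the flat part is the same in all charts, so it may be read off in one chart \<open>c0\<close>, and
  the other part transforms as a tangent vector of \<open>Q\<close>.\<close>

lemma tangent_space_vecE:
  assumes X: "X \<in> tangent_space B x"
  obtains w v where "v \<in> tangent_space A q" "X = ext_vec w v"
proof -
  define W where "W Z = fst (inv (\<lambda>(w, u). J w u) Z)" for Z
  define U where "U Z = snd (inv (\<lambda>(w, u). J w u) Z)" for Z
  have WU: "Z = J (W Z) (U Z)" for Z
    using surj_f_inv_f[OF bij_is_surj[OF bij_J], of Z] by (simp add: W_def U_def case_prod_beta)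
  have X_trans: "transition_deriv x (emb c) (emb c') (X (emb c)) = X (emb c')"
    if "c \<in> Ch" "c' \<in> Ch" for c c'
    using that by (intro tangent_spaceD[OF X] emb_chart)
  have split: "W (X (emb c')) = W (X (emb c)) \<and> U (X (emb c')) = transition_deriv q c c' (U (X (emb c)))"
    if "c \<in> Ch" "c' \<in> Ch" for c c'
  proof -
    have "J (W (X (emb c'))) (U (X (emb c')))
        = J (W (X (emb c))) (transition_deriv q c c' (U (X (emb c))))"
      unfolding transition_J[OF that, symmetric] WU[symmetric] by (rule X_trans[OF that, symmetric])
    then show ?thesis by (simp add: J_eq_iff)
  qed
  define v where "v = (\<lambda>c. if c \<in> Ch then U (X (emb c)) else 0)"
  obtain c0 where c0: "c0 \<in> Ch" using ex_chart by blast
  show thesis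
  proof
    show "v \<in> tangent_space A q"
    proof (rule tangent_spaceI)
      fix c c' assume cc: "c \<in> Ch" "c' \<in> Ch"
      show "transition_deriv q c c' (v c) = v c'"
        using conjunct2[OF split[OF cc], symmetric] cc by (simp add: v_def)
    qed (simp add: v_def)
    show "X = ext_vec (W (X (emb c0))) v"
    proof (rule eq_vecI)
      fix c assume "c \<in> Ch"
      then show "X (emb c) = J (W (X (emb c0))) (v c)"
        using WU[of "X (emb c)"] conjunct1[OF split[OF c0, of c]] by (simp add: v_def)
    qed (rule tangent_spaceD(2)[OF X])
  qed
qed

lemma subspace_ext: "subspace (tangent_space B x)"
proof (rule subspaceI)
  show "0 \<in> tangent_space B x"
    using vec_in_tangent_space[of 0 0] subspace_0[OF subspace_tangent_space] by (simp add: vec_zero)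
  fix X Y k assume X: "X \<in> tangent_space B x" and Y: "Y \<in> tangent_space B x"
  from X obtain w v where "v \<in> tangent_space A q" "X = ext_vec w v" by (rule tangent_space_vecE)
  moreover from Y obtain w' v' where "v' \<in> tangent_space A q" "Y = ext_vec w' v'"
    by (rule tangent_space_vecE)
  ultimately show "X + Y \<in> tangent_space B x" "k *\<^sub>R X \<in> tangent_space B x"
    using subspace_tangent_space
    by (auto simp: vec_add vec_scale subspace_add subspace_scale intro!: vec_in_tangent_space)
qed

lemma dmap_vec:
  assumes "v \<in> tangent_space A q" "C \<in> charts_at B' (F x)"
    and "\<And>c. c \<in> Ch \<Longrightarrow> ((snd C \<circ> F \<circ> chart_inv (emb c)) has_derivative D c) (at (snd (emb c) x))
        \<and> D c (J w (v c)) = Y"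
  shows "dmap B B' F x (ext_vec w v) C = Y"
  using assms ex_chart_ext
  by (intro dmap_eqI[where D = "\<lambda>C. D (inv_into Ch emb C)"] vec_in_tangent_space)
    (auto simp: charts_at_eq inj_emb)

lemma dfun_vec:
  assumes "v \<in> tangent_space A q"
    and "\<And>c. c \<in> Ch \<Longrightarrow> ((f \<circ> chart_inv (emb c)) has_derivative D c) (at (snd (emb c) x))
        \<and> D c (J w (v c)) = Y"
  shows "dfun B f x (ext_vec w v) = Y"
  using assms ex_chart_ext
  by (intro dfun_eqI[where D = "\<lambda>C. D (inv_into Ch emb C)"] vec_in_tangent_space)
    (auto simp: charts_at_eq inj_emb)

text \<open>Meant for inclusions of \<open>Q\<close> with the flat coordinates held constant, whose
  differential has flat part 0.\<close>

lemma dmap_into: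
  assumes v: "v \<in> tangent_space A q" and F: "F q = x"
    and D: "\<And>c c'. c \<in> Ch \<Longrightarrow> c' \<in> Ch \<Longrightarrow> ((snd (emb c') \<circ> F \<circ> chart_inv c) has_derivative
        (\<lambda>h. J 0 (transition_deriv q c c' h))) (at (snd c q))"
  shows "dmap A B F q v = ext_vec 0 v"
proof (rule eq_vecI)
  fix c' assume c': "c' \<in> Ch"
  show "dmap A B F q v (emb c') = J 0 (v c')"
  proof (rule dmap_eqI[OF v ex_chart])
    show "emb c' \<in> charts_at B (F q)" using F emb_chart[OF c'] by simp
    show "((snd (emb c') \<circ> F \<circ> chart_inv c) has_derivative (\<lambda>h. J 0 (transition_deriv q c c' h)))
        (at (snd c q)) \<and> J 0 (transition_deriv q c c' (v c)) = J 0 (v c')" if "c \<in> Ch" for c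
      using D[OF that c'] tangent_spaceD(1)[OF v that c'] by simp
  qed
qed (simp add: dmap_off_charts F)

text \<open>The restriction of a covector to the \<open>Q\<close>-directions, cut off outside the
  tangent space so that it is again an element of \<open>dual_space\<close>.\<close>

definition component :: "(('r, 'f) tvec \<Rightarrow> real) \<Rightarrow> ('p, 'e) tvec \<Rightarrow> real" where
  "component \<omega> = (\<lambda>v. if v \<in> tangent_space A q then \<omega> (ext_vec 0 v) else 0)"

lemma component_dual:
  assumes "\<omega> \<in> dual_space (tangent_space B x)"
  shows "component \<omega> \<in> dual_space (tangent_space A q)"
proof -
  have "\<omega> (ext_vec 0 (v + v')) = \<omega> (ext_vec 0 v) + \<omega> (ext_vec 0 v')"
    if "v \<in> tangent_space A q" "v' \<in> tangent_space A q" for v v'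
    using dual_add[OF assms, of "ext_vec 0 v" "ext_vec 0 v'"] that
    by (simp add: vec_in_tangent_space vec_add)
  moreover have "\<omega> (ext_vec 0 (k *\<^sub>R v)) = k * \<omega> (ext_vec 0 v)" if "v \<in> tangent_space A q" for k v
    using dual_scale[OF assms, of "ext_vec 0 v" k] that by (simp add: vec_in_tangent_space vec_scale)
  ultimately show ?thesis
    using subspace_tangent_space by (simp add: component_def dual_space_def subspace_add subspace_scale)
qed

end

lemma prod_atlas_singleton:
  "prod_atlas {c0} B = (\<lambda>c. (fst c0 \<times> fst c, map_prod (snd c0) (snd c))) ` B"
  "prod_atlas A {c1} = (\<lambda>c. (fst c \<times> fst c1, map_prod (snd c) (snd c1))) ` A"
  unfolding prod_atlas_def by blast+

lemma charts_at_image: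
  "(\<And>c. x' \<in> fst (emb c) \<longleftrightarrow> x \<in> fst c) \<Longrightarrow> charts_at (emb ` A) x' = emb ` charts_at A x"
  unfolding charts_at_def by blast

section \<open>The geometry of a generalized gravitational wave spacetime at a point\<close>

locale ggw_point =
  fixes G :: "('q, 'e::real_normed_vector) ggw"
    and r d :: nat and t y :: real and q :: 'q
  assumes spacetime: "ggw_spacetime r d G"
    and t_in: "t \<in> T_of G" and q_in: "q \<in> topspace (Q_top G)"
begin

lemma ggw_point_atlas: "atlas_point (Q_atlas G) q"
  using spacetime q_in by (intro Ck_manifold_atlas_point[of r d]) (simp_all add: ggw_spacetime_def)

lemma open_T: "open (T_of G)"
  using spacetime by (simp add: ggw_spacetime_def)

end

sublocale ggw_point \<subseteq> atlas_point "Q_atlas G" q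
  by (rule ggw_point_atlas)

sublocale ggw_point \<subseteq> a: inner_product_space "TQ G q" "a_of G t q"
proof
  show "inner_product_on (TQ G q) (a_of G t q)"
    using spacetime t_in q_in by (simp add: ggw_spacetime_def)
  obtain B :: "'e set" where "finite B" "span B = UNIV"
    using spacetime unfolding ggw_spacetime_def Ck_manifold_def by blast
  then show "\<exists>F. finite F \<and> TQ G q = span F" by (rule finite_span_tangent_space)
qed (rule subspace_tangent_space)

context ggw_point
begin

lemma b_dual: "b_of G t q \<in> dual_space (TQ G q)"
  using spacetime t_in q_in by (simp add: ggw_spacetime_def)

definition chart_E :: "('q, 'e) chart \<Rightarrow> (real \<times> 'q, real \<times> 'e) chart" where
  "chart_E c = (T_of G \<times> fst c, map_prod id (snd c))"

definition chart_M :: "('q, 'e) chart \<Rightarrow> (real \<times> 'q \<times> real, real \<times> 'e \<times> real) chart" where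
  "chart_M c = (T_of G \<times> fst c \<times> UNIV, map_prod id (map_prod (snd c) id))"

definition chart_N :: "('q, 'e) chart \<Rightarrow> (real \<times> 'q \<times> real, 'e \<times> real) chart" where
  "chart_N c = ({t} \<times> fst c \<times> UNIV, map_prod (snd c) id \<circ> snd)"

lemma snd_chart [simp]:
  "snd (chart_E c) (s, p) = (s, snd c p)"
  "snd (chart_M c) (s, p, h) = (s, snd c p, h)"
  "snd (chart_N c) (s, p, h) = (snd c p, h)"
  by (simp_all add: chart_E_def chart_M_def chart_N_def)

lemma atlas_eq_image:
  "E_atlas G = chart_E ` Q_atlas G"
  "M_atlas G = chart_M ` Q_atlas G"
  "N_atlas G t = chart_N ` Q_atlas G"
  unfolding E_atlas_def M_atlas_def N_atlas_def Setcompr_eq_image prod_atlas_singleton image_image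
    chart_E_def chart_M_def chart_N_def by simp_all

lemma charts_at_eq_image:
  "charts_at (E_atlas G) (t, q) = chart_E ` Ch"
  "charts_at (M_atlas G) (t, q, y) = chart_M ` Ch"
  "charts_at (N_atlas G t) (t, q, y) = chart_N ` Ch"
  unfolding atlas_eq_image
  by (rule charts_at_image; simp add: t_in chart_E_def chart_M_def chart_N_def)+

text \<open>The domain of \<open>c\<close> can be recovered from the product because the other
  factors are nonempty (\<open>T_of G\<close> contains \<open>t\<close>), and the coordinate map
  from its middle component.\<close>

lemma inj_chart:
  "inj_on chart_E Ch" "inj_on chart_M Ch" "inj_on chart_N Ch"
proof -
  have fst_eq: "fst c = fst c'"
    if "c \<in> Ch" "c' \<in> Ch" "T_of G \<times> fst c = T_of G \<times> fst c' \<or>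
      T_of G \<times> fst c \<times> (UNIV :: real set) = T_of G \<times> fst c' \<times> UNIV
      \<or> {t} \<times> fst c \<times> (UNIV :: real set) = {t} \<times> fst c' \<times> UNIV" for c c'
    using that t_in by (auto simp: times_eq_iff)
  have snd_eq: "snd c = snd c'" if "\<And>z. snd c z = snd c' z" for c c' :: "('q, 'e) chart"
    using that by blast
  show "inj_on chart_E Ch"
    by (intro inj_onI prod_eqI fst_eq snd_eq) (auto simp: chart_E_def map_prod_def fun_eq_iff)
  show "inj_on chart_M Ch"
    by (intro inj_onI prod_eqI fst_eq snd_eq) (auto simp: chart_M_def map_prod_def fun_eq_iff)
  show "inj_on chart_N Ch"
    by (intro inj_onI prod_eqI fst_eq snd_eq) (auto simp: chart_N_def map_prod_def fun_eq_iff)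
qed

lemma chart_inv_product:
  assumes "c \<in> Ch" "z \<in> snd c ` fst c"
  shows "s \<in> T_of G \<Longrightarrow> chart_inv (chart_E c) (s, z) = (s, chart_inv c z)"
    and "s \<in> T_of G \<Longrightarrow> chart_inv (chart_M c) (s, z, h) = (s, chart_inv c z, h)"
    and "chart_inv (chart_N c) (z, h) = (t, chart_inv c z, h)"
proof -
  have inj: "inj_on (snd c) (fst c)" using chart_inj assms by blast
  have z: "chart_inv c z \<in> fst c" "snd c (chart_inv c z) = z"
    using assms(2) by (auto simp: chart_inv_def inv_into_into f_inv_into_f)
  show "s \<in> T_of G \<Longrightarrow> chart_inv (chart_E c) (s, z) = (s, chart_inv c z)"
    using inj z by (intro chart_inv_eq) (auto simp: chart_E_def inj_on_def)
  show "s \<in> T_of G \<Longrightarrow> chart_inv (chart_M c) (s, z, h) = (s, chart_inv c z, h)"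
    using inj z by (intro chart_inv_eq) (auto simp: chart_M_def inj_on_def)
  show "chart_inv (chart_N c) (z, h) = (t, chart_inv c z, h)"
    using inj z by (intro chart_inv_eq) (auto simp: chart_N_def inj_on_def)
qed

text \<open>Each coordinate expression below coincides, on the open set of coordinates of the chart,
  with an expression free of \<open>chart_inv\<close> of product charts.\<close>

lemma has_derivative_chart_E:
  assumes "c \<in> Ch" "(g has_derivative g') (at (t, snd c q))"
    and "\<And>s z. s \<in> T_of G \<Longrightarrow> z \<in> snd c ` fst c \<Longrightarrow> f (s, chart_inv c z) = g (s, z)"
  shows "((f \<circ> chart_inv (chart_E c)) has_derivative g') (at (t, snd c q))"
proof (rule has_derivative_transform_within_open[OF assms(2)])
  show "open (T_of G \<times> snd c ` fst c)"
    by (intro open_Times open_T chart_range_open assms)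
  show "(t, snd c q) \<in> T_of G \<times> snd c ` fst c"
    using in_chart[OF assms(1)] t_in by blast
  fix w assume "w \<in> T_of G \<times> snd c ` fst c"
  then obtain s z where "w = (s, z)" "s \<in> T_of G" "z \<in> snd c ` fst c" by blast
  then show "g w = (f \<circ> chart_inv (chart_E c)) w"
    by (simp only: comp_apply chart_inv_product[OF assms(1)] assms(3))
qed

lemma has_derivative_chart_M:
  assumes "c \<in> Ch" "(g has_derivative g') (at (t, snd c q, y))"
    and "\<And>s z h. s \<in> T_of G \<Longrightarrow> z \<in> snd c ` fst c \<Longrightarrow> f (s, chart_inv c z, h) = g (s, z, h)"
  shows "((f \<circ> chart_inv (chart_M c)) has_derivative g') (at (t, snd c q, y))"
proof (rule has_derivative_transform_within_open[OF assms(2)])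
  show "open (T_of G \<times> snd c ` fst c \<times> UNIV)"
    by (intro open_Times open_T open_UNIV chart_range_open assms)
  show "(t, snd c q, y) \<in> T_of G \<times> snd c ` fst c \<times> UNIV"
    using in_chart[OF assms(1)] t_in by blast
  fix w :: "real \<times> 'e \<times> real" assume "w \<in> T_of G \<times> snd c ` fst c \<times> UNIV"
  then obtain s z h where "w = (s, z, h)" "s \<in> T_of G" "z \<in> snd c ` fst c" by blast
  then show "g w = (f \<circ> chart_inv (chart_M c)) w"
    by (simp only: comp_apply chart_inv_product[OF assms(1)] assms(3))
qed

lemma has_derivative_chart_N:
  assumes "c \<in> Ch" "(g has_derivative g') (at (snd c q, y))"
    and "\<And>z h. z \<in> snd c ` fst c \<Longrightarrow> f (t, chart_inv c z, h) = g (z, h)"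
  shows "((f \<circ> chart_inv (chart_N c)) has_derivative g') (at (snd c q, y))"
proof (rule has_derivative_transform_within_open[OF assms(2)])
  show "open (snd c ` fst c \<times> UNIV)"
    by (intro open_Times open_UNIV chart_range_open assms)
  show "(snd c q, y) \<in> snd c ` fst c \<times> UNIV"
    using in_chart[OF assms(1)] t_in by blast
  fix w :: "'e \<times> real" assume "w \<in> snd c ` fst c \<times> UNIV"
  then obtain z h where "w = (z, h)" "z \<in> snd c ` fst c" by blast
  then show "g w = (f \<circ> chart_inv (chart_N c)) w"
    by (simp only: comp_apply chart_inv_product[OF assms(1)] assms(3))
qed

lemmas transition_intros = transition_compose_has_derivative has_derivative_Pair
  has_derivative_fst has_derivative_snd has_derivative_ident has_derivative_const

end

sublocale ggw_point \<subseteq> E: flat_extension "Q_atlas G" q "E_atlas G" "(t, q)" chart_E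
  "\<lambda>\<tau> u. (\<tau> :: real, u)"
proof
  fix c c' w u assume c: "c \<in> Ch" "c' \<in> Ch"
  have "((snd (chart_E c') \<circ> chart_inv (chart_E c)) has_derivative
      (\<lambda>h. (fst h, transition_deriv q c c' (snd h)))) (at (t, snd c q))"
    by (rule has_derivative_chart_E[OF c(1),
        where g = "\<lambda>w. (fst w, snd c' (chart_inv c (snd w)))"])
      (auto intro!: transition_intros c)
  then show "transition_deriv (t, q) (chart_E c) (chart_E c') (w, u) = (w, transition_deriv q c c' u)"
    by (simp flip: frechet_derivative_at)
qed (auto simp: charts_at_eq_image inj_chart case_prod_unfold bij_def inj_def surj_def intro!: linearI)

text \<open>The two flat coordinates lie on either side of the \<open>Q\<close>-coordinate, so
  \<open>J\<close> takes them as a pair and places \<open>u\<close> between them.\<close>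

sublocale ggw_point \<subseteq> M: flat_extension "Q_atlas G" q "M_atlas G" "(t, q, y)" chart_M
  "\<lambda>(\<tau> :: real, \<sigma> :: real) u. (\<tau>, u, \<sigma>)"
proof
  fix c c' u and w :: "real \<times> real" assume c: "c \<in> Ch" "c' \<in> Ch"
  have "((snd (chart_M c') \<circ> chart_inv (chart_M c)) has_derivative
      (\<lambda>h. (fst h, transition_deriv q c c' (fst (snd h)), snd (snd h)))) (at (t, snd c q, y))"
    by (rule has_derivative_chart_M[OF c(1),
        where g = "\<lambda>w. (fst w, snd c' (chart_inv c (fst (snd w))), snd (snd w))"])
      (auto intro!: transition_intros c)
  then show "transition_deriv (t, q, y) (chart_M c) (chart_M c') ((\<lambda>(\<tau>, \<sigma>) u. (\<tau>, u, \<sigma>)) w u)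
      = (\<lambda>(\<tau>, \<sigma>) u. (\<tau>, u, \<sigma>)) w (transition_deriv q c c' u)"
    by (simp add: case_prod_unfold flip: frechet_derivative_at)
qed (auto simp: charts_at_eq_image inj_chart case_prod_unfold bij_def inj_def surj_def intro!: linearI)

sublocale ggw_point \<subseteq> N: flat_extension "Q_atlas G" q "N_atlas G t" "(t, q, y)" chart_N
  "\<lambda>\<sigma> u. (u, \<sigma> :: real)"
proof
  fix c c' w u assume c: "c \<in> Ch" "c' \<in> Ch"
  have "((snd (chart_N c') \<circ> chart_inv (chart_N c)) has_derivative
      (\<lambda>h. (transition_deriv q c c' (fst h), snd h))) (at (snd c q, y))"
    by (rule has_derivative_chart_N[OF c(1),
        where g = "\<lambda>w. (snd c' (chart_inv c (fst w)), snd w)"])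
      (auto intro!: transition_intros c)
  then show "transition_deriv (t, q, y) (chart_N c) (chart_N c') (u, w) = (transition_deriv q c c' u, w)"
    by (simp flip: frechet_derivative_at)
qed (auto simp: charts_at_eq_image inj_chart case_prod_unfold bij_def inj_def surj_def intro!: linearI)

section \<open>Coordinate fields, lifts, coordinate forms and projections in flat and
  \<open>Q\<close>-components\<close>

context ggw_point
begin

abbreviation "vecE \<tau> v \<equiv> E.ext_vec \<tau> v"
abbreviation "vecM \<tau> v \<sigma> \<equiv> M.ext_vec (\<tau>, \<sigma>) v"
abbreviation "vecN v \<sigma> \<equiv> N.ext_vec \<sigma> v"

lemma zero_in_TQ [simp]: "0 \<in> TQ G q"
  using subspace_0[OF subspace_tangent_space] .

lemma velocity_flat:
  "del_t_E G (t, q) = vecE 1 0"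
  "del_t G (t, q, y) = vecM 1 0 0"
  "n_vec G (t, q, y) = vecM 0 0 1"
  "n_vec_N G (t, q, y) = vecN 0 1"
proof -
  note vd = has_vector_derivative_Pair has_vector_derivative_id has_vector_derivative_const
  show "del_t_E G (t, q) = vecE 1 0"
    unfolding del_t_E_def case_prod_conv
    by (rule E.eq_vecI, rule velocity_eqI)
      (auto simp: E.emb_chart velocity_def comp_def intro!: vd)
  show "del_t G (t, q, y) = vecM 1 0 0"
    unfolding del_t_def case_prod_conv
    by (rule M.eq_vecI, rule velocity_eqI)
      (auto simp: M.emb_chart velocity_def comp_def intro!: vd)
  show "n_vec G (t, q, y) = vecM 0 0 1"
    unfolding n_vec_def case_prod_conv
    by (rule M.eq_vecI, rule velocity_eqI)
      (auto simp: M.emb_chart velocity_def comp_def intro!: vd)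
  show "n_vec_N G (t, q, y) = vecN 0 1"
    unfolding n_vec_N_def case_prod_conv
    by (rule N.eq_vecI, rule velocity_eqI)
      (auto simp: N.emb_chart velocity_def comp_def intro!: vd)
qed

lemma lift_eq:
  assumes "v \<in> TQ G q"
  shows "lift_E G (t, q) v = vecE 0 v" "lift_M G (t, q, y) v = vecM 0 v 0"
proof -
  have dE: "((snd (chart_E c') \<circ> (\<lambda>q'. (t, q')) \<circ> chart_inv c) has_derivative
      (\<lambda>h. (0, transition_deriv q c c' h))) (at (snd c q))"
    and dM: "((snd (chart_M c') \<circ> (\<lambda>q'. (t, q', y)) \<circ> chart_inv c) has_derivative
      (\<lambda>h. (0, transition_deriv q c c' h, 0))) (at (snd c q))"
    if c: "c \<in> Ch" "c' \<in> Ch" for c c'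
  proof -
    have "snd (chart_E c') \<circ> (\<lambda>q'. (t, q')) \<circ> chart_inv c = (\<lambda>z. (t, snd c' (chart_inv c z)))"
      "snd (chart_M c') \<circ> (\<lambda>q'. (t, q', y)) \<circ> chart_inv c = (\<lambda>z. (t, snd c' (chart_inv c z), y))"
      by (simp_all add: fun_eq_iff)
    then show "((snd (chart_E c') \<circ> (\<lambda>q'. (t, q')) \<circ> chart_inv c) has_derivative
        (\<lambda>h. (0, transition_deriv q c c' h))) (at (snd c q))"
      "((snd (chart_M c') \<circ> (\<lambda>q'. (t, q', y)) \<circ> chart_inv c) has_derivative
        (\<lambda>h. (0, transition_deriv q c c' h, 0))) (at (snd c q))"
      by (auto intro!: transition_intros c)
  qed
  show "lift_E G (t, q) v = vecE 0 v"
    unfolding lift_E_def case_prod_conv using dE by (intro E.dmap_into[OF assms]) auto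
  show "lift_M G (t, q, y) v = vecM 0 v 0"
    \<comment> \<open>The flat part here is the pair (0, 0), which has to be read as the zero of the
      product to match \<open>M.dmap_into\<close>.\<close>
    unfolding lift_M_def case_prod_conv zero_prod_def[symmetric]
    using dM by (intro M.dmap_into[OF assms]) (auto simp: zero_prod_def)
qed

lemma flat_forms:
  assumes "v \<in> TQ G q"
  shows "dt_E G (t, q) (vecE \<tau> v) = \<tau>"
    and "dt G (t, q, y) (vecM \<tau> v \<sigma>) = \<tau>"
    and "dy G (t, q, y) (vecM \<tau> v \<sigma>) = \<sigma>"
    and "dy_N G (t, q, y) (vecN v \<sigma>) = \<sigma>"
proof -
  note intros = has_derivative_fst has_derivative_snd has_derivative_ident
  show "dt_E G (t, q) (vecE \<tau> v) = \<tau>"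
    unfolding dt_E_def
    by (rule E.dfun_vec[OF assms, where D = "\<lambda>_. fst"])
      (auto intro!: has_derivative_chart_E[where g = fst] intros)
  show "dt G (t, q, y) (vecM \<tau> v \<sigma>) = \<tau>"
    unfolding dt_def
    by (rule M.dfun_vec[OF assms, where D = "\<lambda>_. fst"])
      (auto intro!: has_derivative_chart_M[where g = fst] intros)
  show "dy G (t, q, y) (vecM \<tau> v \<sigma>) = \<sigma>"
    unfolding dy_def
    by (rule M.dfun_vec[OF assms, where D = "\<lambda>_ h. snd (snd h)"])
      (auto intro!: has_derivative_chart_M[where g = "\<lambda>h. snd (snd h)"] intros)
  show "dy_N G (t, q, y) (vecN v \<sigma>) = \<sigma>"
    unfolding dy_N_def case_prod_conv
    by (rule N.dfun_vec[OF assms, where D = "\<lambda>_. snd"])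
      (auto intro!: has_derivative_chart_N[where g = snd] intros)
qed

text \<open>In coordinates each map is a projection or inclusion followed by a chart change of
  \<open>Q\<close>, so its derivative is \<open>transition_deriv q c C\<close> on the
  \<open>Q\<close>-part, and compatibility of \<open>v\<close> turns \<open>v c\<close> into
  \<open>v C\<close>.\<close>

lemma pushforwards:
  assumes v: "v \<in> TQ G q"
  shows "push_Q G (t, q, y) (vecM \<tau> v \<sigma>) = v"
    and "push_E G (t, q, y) (vecM \<tau> v \<sigma>) = vecE \<tau> v"
    and "dmap (N_atlas G t) (Q_atlas G) (\<lambda>(t', q', y'). q') (t, q, y) (vecN v \<sigma>) = v"
    and "dmap (N_atlas G t) (M_atlas G) (\<lambda>x. x) (t, q, y) (vecN v \<sigma>) = vecM 0 v \<sigma>"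
proof -
  note Ch_trans = tangent_spaceD(1)[OF v] and Ch_off = tangent_spaceD(2)[OF v]
  show "push_Q G (t, q, y) (vecM \<tau> v \<sigma>) = v"
  proof
    fix C show "push_Q G (t, q, y) (vecM \<tau> v \<sigma>) C = v C"
    proof (cases "C \<in> Ch")
      case True
      show ?thesis
        unfolding push_Q_def
        by (rule M.dmap_vec[OF v, where D = "\<lambda>c h. transition_deriv q c C (fst (snd h))"])
          (use True in \<open>auto simp: Ch_trans intro!: transition_intros
            has_derivative_chart_M[where g = "\<lambda>w. snd C (chart_inv _ (fst (snd w)))"]\<close>)
    qed (simp add: push_Q_def dmap_off_charts Ch_off)
  qed
  show "push_E G (t, q, y) (vecM \<tau> v \<sigma>) = vecE \<tau> v"
    unfolding push_E_def
  proof (rule E.eq_vecI)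
    fix C assume C: "C \<in> Ch"
    show "dmap (M_atlas G) (E_atlas G) (\<lambda>(t, q, y). (t, q)) (t, q, y) (vecM \<tau> v \<sigma>) (chart_E C) = (\<tau>, v C)"
      by (rule M.dmap_vec[OF v, where D = "\<lambda>c h. (fst h, transition_deriv q c C (fst (snd h)))"])
        (use C E.emb_chart in \<open>auto simp: Ch_trans intro!: transition_intros
          has_derivative_chart_M[where g = "\<lambda>w. (fst w, snd C (chart_inv _ (fst (snd w))))"]\<close>)
  qed (simp add: dmap_off_charts)
  show "dmap (N_atlas G t) (Q_atlas G) (\<lambda>(t', q', y'). q') (t, q, y) (vecN v \<sigma>) = v"
  proof
    fix C show "dmap (N_atlas G t) (Q_atlas G) (\<lambda>(t', q', y'). q') (t, q, y) (vecN v \<sigma>) C = v C"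
    proof (cases "C \<in> Ch")
      case True
      show ?thesis
        by (rule N.dmap_vec[OF v, where D = "\<lambda>c h. transition_deriv q c C (fst h)"])
          (use True in \<open>auto simp: Ch_trans intro!: transition_intros
            has_derivative_chart_N[where g = "\<lambda>w. snd C (chart_inv _ (fst w))"]\<close>)
    qed (simp add: dmap_off_charts Ch_off)
  qed
  show "dmap (N_atlas G t) (M_atlas G) (\<lambda>x. x) (t, q, y) (vecN v \<sigma>) = vecM 0 v \<sigma>"
  proof (rule M.eq_vecI)
    fix C assume C: "C \<in> Ch"
    have "dmap (N_atlas G t) (M_atlas G) (\<lambda>x. x) (t, q, y) (vecN v \<sigma>) (chart_M C) = (0, v C, \<sigma>)"
      by (rule N.dmap_vec[OF v, where D = "\<lambda>c h. (0, transition_deriv q c C (fst h), snd h)"])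
        (use C M.emb_chart in \<open>auto simp: Ch_trans intro!: transition_intros
          has_derivative_chart_N[where g = "\<lambda>w. (t, snd C (chart_inv _ (fst w)), snd w)"]\<close>)
    then show "dmap (N_atlas G t) (M_atlas G) (\<lambda>x. x) (t, q, y) (vecN v \<sigma>) (chart_M C)
      = (case (0, \<sigma>) of (\<tau>, \<sigma>) \<Rightarrow> \<lambda>u. (\<tau>, u, \<sigma>)) (v C)" by simp
  qed (simp add: dmap_off_charts)
qed

end

section \<open>Covectors on the spacetime\<close>

context ggw_point
begin

abbreviation "z \<equiv> (t, q, y)"
abbreviation "aQ \<equiv> a_of G t q"
abbreviation "bQ \<equiv> b_of G t q"
abbreviation "VQ \<equiv> V_of G t q"
abbreviation "dual_Q \<equiv> dual_space (TQ G q)"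
abbreviation "dual_M \<equiv> dual_space (TM G z)"
abbreviation "dual_N \<equiv> dual_space (TN G t z)"

lemma TM_E:
  assumes "X \<in> TM G z"
  obtains \<tau> v \<sigma> where "v \<in> TQ G q" "X = vecM \<tau> v \<sigma>"
  using assms by (rule M.tangent_space_vecE) (metis surj_pair)

lemma M_vec_iff:
  "v \<in> TQ G q \<Longrightarrow> v' \<in> TQ G q \<Longrightarrow> vecM \<tau> v \<sigma> = vecM \<tau>' v' \<sigma>' \<longleftrightarrow> \<tau> = \<tau>' \<and> v = v' \<and> \<sigma> = \<sigma>'"
  by (auto simp: M.vec_eq_iff)

lemma vecM_in [simp]: "v \<in> TQ G q \<Longrightarrow> vecM \<tau> v \<sigma> \<in> TM G z"
  by (rule M.vec_in_tangent_space)

lemma vecN_in [simp]: "v \<in> TQ G q \<Longrightarrow> vecN v \<sigma> \<in> TN G t z"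
  by (rule N.vec_in_tangent_space)

lemma TQ_closed [simp]:
  "v \<in> TQ G q \<Longrightarrow> v' \<in> TQ G q \<Longrightarrow> v + v' \<in> TQ G q"
  "v \<in> TQ G q \<Longrightarrow> k *\<^sub>R v \<in> TQ G q"
  "v \<in> TQ G q \<Longrightarrow> - v \<in> TQ G q"
  using subspace_tangent_space by (auto simp: subspace_add subspace_scale subspace_neg)

lemma dual_M_I:
  assumes p: "p \<in> dual_Q"
    and \<eta>: "\<And>\<tau> v \<sigma>. v \<in> TQ G q \<Longrightarrow> \<eta> (vecM \<tau> v \<sigma>) = h * \<tau> + p v + k * \<sigma>"
    and off: "\<And>X. X \<notin> TM G z \<Longrightarrow> \<eta> X = 0"
  shows "\<eta> \<in> dual_M"
  unfolding dual_space_def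
proof (intro CollectI conjI ballI allI impI)
  fix X Y c assume "X \<in> TM G z"
  then obtain \<tau> v \<sigma> where X: "v \<in> TQ G q" "X = vecM \<tau> v \<sigma>" by (rule TM_E)
  then show "\<eta> (c *\<^sub>R X) = c * \<eta> X"
    by (simp add: M.vec_scale \<eta> dual_scale[OF p] algebra_simps)
  assume "Y \<in> TM G z"
  then obtain \<tau>' v' \<sigma>' where Y: "v' \<in> TQ G q" "Y = vecM \<tau>' v' \<sigma>'" by (rule TM_E)
  with X show "\<eta> (X + Y) = \<eta> X + \<eta> Y"
    by (simp add: M.vec_add \<eta> dual_add[OF p] algebra_simps)
qed (rule off)

lemma dual_N_I:
  assumes p: "p \<in> dual_Q"
    and \<omega>: "\<And>v \<sigma>. v \<in> TQ G q \<Longrightarrow> \<omega> (vecN v \<sigma>) = p v + k * \<sigma>"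
    and off: "\<And>X. X \<notin> TN G t z \<Longrightarrow> \<omega> X = 0"
  shows "\<omega> \<in> dual_N"
  unfolding dual_space_def
proof (intro CollectI conjI ballI allI impI)
  fix X Y c assume "X \<in> TN G t z"
  then obtain \<sigma> v where X: "v \<in> TQ G q" "X = vecN v \<sigma>" by (rule N.tangent_space_vecE)
  then show "\<omega> (c *\<^sub>R X) = c * \<omega> X"
    by (simp add: N.vec_scale \<omega> dual_scale[OF p] algebra_simps)
  assume "Y \<in> TN G t z"
  then obtain \<sigma>' v' where Y: "v' \<in> TQ G q" "Y = vecN v' \<sigma>'" by (rule N.tangent_space_vecE)
  with X show "\<omega> (X + Y) = \<omega> X + \<omega> Y"
    by (simp add: N.vec_add \<omega> dual_add[OF p] algebra_simps)
qed (rule off)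

lemma dual_M_expand:
  assumes \<eta>: "\<eta> \<in> dual_M" and v: "v \<in> TQ G q"
  shows "\<eta> (vecM \<tau> v \<sigma>) = \<eta> (vecM 1 0 0) * \<tau> + M.component \<eta> v + \<eta> (vecM 0 0 1) * \<sigma>"
proof -
  have "vecM \<tau> v \<sigma> = \<tau> *\<^sub>R vecM 1 0 0 + M.ext_vec 0 v + \<sigma> *\<^sub>R vecM 0 0 1"
    by (simp add: M.vec_scale M.vec_add zero_prod_def)
  then show ?thesis
    using v by (simp add: M.component_def dual_add[OF \<eta>] dual_scale[OF \<eta>] subspace_add[OF M.subspace_ext]
        subspace_scale[OF M.subspace_ext] M.vec_in_tangent_space)
qed

lemma dual_N_expand:
  assumes \<omega>: "\<omega> \<in> dual_N" and v: "v \<in> TQ G q"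
  shows "\<omega> (vecN v \<sigma>) = N.component \<omega> v + \<omega> (vecN 0 1) * \<sigma>"
proof -
  have "vecN v \<sigma> = vecN v 0 + \<sigma> *\<^sub>R vecN 0 1"
    by (simp add: N.vec_scale N.vec_add)
  then show ?thesis
    using v by (simp add: N.component_def dual_add[OF \<omega>] dual_scale[OF \<omega>] subspace_scale[OF N.subspace_ext])
qed

lemma pull_vec:
  assumes "v \<in> TQ G q"
  shows "pull_M G z p (vecM \<tau> v \<sigma>) = p v"
    and "pull_N G z p (vecN v \<sigma>) = p v"
    and "restrict_N G z \<eta> (vecN v \<sigma>) = \<eta> (vecM 0 v \<sigma>)"
  using pushforwards[OF assms]
  by (simp_all add: pull_M_def pull_N_def restrict_N_def pullback_def push_Q_def)

text \<open>Off the tangent space \<open>dmap\<close> is the zero vector, on which every covector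
  vanishes; pullbacks thus respect the extension by 0.\<close>

lemma pull_off:
  shows "X \<notin> TM G z \<Longrightarrow> p \<in> dual_Q \<Longrightarrow> pull_M G z p X = 0"
    and "X' \<notin> TN G t z \<Longrightarrow> p \<in> dual_Q \<Longrightarrow> pull_N G z p X' = 0"
    and "X' \<notin> TN G t z \<Longrightarrow> \<eta> \<in> dual_M \<Longrightarrow> restrict_N G z \<eta> X' = 0"
  by (simp_all add: pull_M_def pull_N_def restrict_N_def pullback_def dmap_off_tangent_space dual_zero)

lemma flat_forms_off:
  "X \<notin> TM G z \<Longrightarrow> dt G z X = 0" "X \<notin> TM G z \<Longrightarrow> dy G z X = 0" "X' \<notin> TN G t z \<Longrightarrow> dy_N G z X' = 0"
  by (simp_all add: dt_def dy_def dy_N_def dfun_off_tangent_space)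

text \<open>The coefficient \<open>h\<close> of \<open>dt\<close> stays free: these are the
  candidates among which the lightlike form extending a given form on the slice is found.\<close>

definition cov_M :: "(('q, 'e) tvec \<Rightarrow> real) \<Rightarrow> real \<Rightarrow> (real \<times> 'q \<times> real, real \<times> 'e \<times> real) tvec \<Rightarrow> real" where
  "cov_M p h = dy G z - pull_M G z p + h *\<^sub>R dt G z"

definition cov_N :: "(('q, 'e) tvec \<Rightarrow> real) \<Rightarrow> (real \<times> 'q \<times> real, 'e \<times> real) tvec \<Rightarrow> real" where
  "cov_N p = dy_N G z - pull_N G z p"

lemma cov_vec [simp]:
  assumes "v \<in> TQ G q"
  shows "cov_M p h (vecM \<tau> v \<sigma>) = \<sigma> - p v + h * \<tau>" "cov_N p (vecN v \<sigma>) = \<sigma> - p v"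
  using assms by (simp_all add: cov_M_def cov_N_def flat_forms pull_vec)

lemma dual_Q_uminus: "p \<in> dual_Q \<Longrightarrow> - p \<in> dual_Q"
  using dual_space_scale[of p _ "-1"] by (simp add: scaleR_fun_def fun_Compl_def)

lemma cov_dual:
  assumes p: "p \<in> dual_Q"
  shows "cov_M p h \<in> dual_M" "cov_N p \<in> dual_N"
proof -
  show "cov_M p h \<in> dual_M"
    by (rule dual_M_I[OF dual_Q_uminus[OF p], of _ h 1], simp,
        simp add: cov_M_def flat_forms_off pull_off p)
  show "cov_N p \<in> dual_N"
    by (rule dual_N_I[OF dual_Q_uminus[OF p], of _ 1], simp,
        simp add: cov_N_def flat_forms_off pull_off p)
qed

lemma cov_N_eq_iff:
  assumes "p \<in> dual_Q" "p' \<in> dual_Q"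
  shows "cov_N p = cov_N p' \<longleftrightarrow> p = p'"
proof
  assume eq: "cov_N p = cov_N p'"
  show "p = p'"
  proof (rule dual_eqI[OF assms])
    fix v assume "v \<in> TQ G q"
    then show "p v = p' v" using fun_cong[OF eq, of "vecN v 0"] by simp
  qed
qed simp

lemma cov_N_E:
  assumes "\<omega> \<in> dual_N" "\<omega> (n_vec_N G z) = 1"
  obtains p where "p \<in> dual_Q" "\<omega> = cov_N p"
proof -
  define p where "p = N.component \<omega>"
  have p: "p \<in> dual_Q" "\<And>v \<sigma>. v \<in> TQ G q \<Longrightarrow> \<omega> (vecN v \<sigma>) = p v + \<sigma>"
    unfolding p_def
    by (rule N.component_dual[OF assms(1)], subst dual_N_expand[OF assms(1)])
      (use assms(2) in \<open>simp_all add: velocity_flat\<close>)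
  \<comment> \<open>The sign comes from writing the form as \<open>dy - p\<close>; the hypothesis on
    \<open>n\<close> has made the coefficient of \<open>dy\<close> equal to 1.\<close>
  have "\<omega> = cov_N (- p)"
  proof (rule dual_eqI[OF assms(1) cov_dual(2)[OF dual_Q_uminus[OF p(1)]]])
    fix X assume "X \<in> TN G t z"
    then obtain \<sigma> v where "v \<in> TQ G q" "X = vecN v \<sigma>" by (rule N.tangent_space_vecE)
    then show "\<omega> X = cov_N (- p) X" by (simp add: p)
  qed
  then show thesis using that dual_Q_uminus[OF p(1)] by blast
qed

section \<open>The metric\<close>

lemma gmetric_vec:
  assumes "v \<in> TQ G q" "v' \<in> TQ G q"
  shows "gmetric G z (vecM \<tau> v \<sigma>) (vecM \<tau>' v' \<sigma>') =
    aQ v v' - \<tau> * (\<sigma>' - bQ v') - (\<sigma> - bQ v) * \<tau>' - 2 * VQ * \<tau> * \<tau>'"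
  using assms by (simp add: gmetric_def Let_def pushforwards flat_forms pull_vec)

lemma gmetric_sym: "gmetric G z X Y = gmetric G z Y X"
  by (simp add: gmetric_def Let_def a.B_sym algebra_simps)

lemma gmetric_off: "X \<notin> TM G z \<Longrightarrow> gmetric G z X Y = 0"
  by (simp add: gmetric_def Let_def push_Q_def dmap_off_tangent_space flat_forms_off pull_off b_dual)

text \<open>Compare coefficients in \<open>g(Y, X) = \<eta>(Y)\<close>: that of
  \<open>\<sigma>\<close> gives the first component of \<open>X\<close>, that of \<open>v\<close>
  the equation for \<open>u\<close>, that of \<open>\<tau>\<close> the last component.\<close>

lemma sharp_gmetric:
  assumes u: "u \<in> TQ G q" "\<And>v. v \<in> TQ G q \<Longrightarrow> aQ v u = p v + k * bQ v"
    and \<eta>: "\<And>\<tau> v \<sigma>. v \<in> TQ G q \<Longrightarrow> \<eta> (vecM \<tau> v \<sigma>) = h * \<tau> + p v + k * \<sigma>"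
  shows "sharp (TM G z) (gmetric G z) \<eta> = vecM (- k) u (bQ u + 2 * VQ * k - h)"
proof (rule sharp_eqI)
  show "vecM (- k) u (bQ u + 2 * VQ * k - h) \<in> TM G z" using u by simp
next
  fix Y assume "Y \<in> TM G z"
  then obtain \<tau> v \<sigma> where "v \<in> TQ G q" "Y = vecM \<tau> v \<sigma>" by (rule TM_E)
  then show "gmetric G z Y (vecM (- k) u (bQ u + 2 * VQ * k - h)) = \<eta> Y"
    using u by (simp add: gmetric_vec \<eta> algebra_simps)
next
  fix X' assume X': "X' \<in> TM G z" and
    eq: "\<And>Y. Y \<in> TM G z \<Longrightarrow> gmetric G z Y X' = gmetric G z Y (vecM (- k) u (bQ u + 2 * VQ * k - h))"
  from X' obtain \<tau> v \<sigma> where v: "v \<in> TQ G q" and X'_eq: "X' = vecM \<tau> v \<sigma>" by (rule TM_E)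
  \<comment> \<open>The system is triangular: testing with \<open>n\<close>, then
    \<open>Q\<close>-directions, then \<open>\<partial>_t\<close> determines one component after the
    other, and only the middle test needs nondegeneracy of \<open>a\<close>.\<close>
  have \<tau>: "\<tau> = - k"
    using eq[of "vecM 0 0 1"] v u(1) by (simp add: X'_eq gmetric_vec dual_zero[OF b_dual])
  moreover have "v = u"
  proof (rule a.B_nondegenerate[OF v u(1)])
    fix w assume "w \<in> TQ G q"
    then show "aQ w v = aQ w u"
      using eq[of "vecM 0 w 0"] v u(1) by (simp add: X'_eq gmetric_vec \<tau>)
  qed
  moreover have "\<sigma> = bQ u + 2 * VQ * k - h"
    using eq[of "vecM 1 0 0"] v u(1) calculation
    by (simp add: X'_eq gmetric_vec dual_zero[OF b_dual])
  ultimately show "X' = vecM (- k) u (bQ u + 2 * VQ * k - h)" by (simp add: X'_eq)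
qed

text \<open>Riesz representation for \<open>a\<close>, applied to \<open>p + k *\<^sub>R bQ\<close>,
  supplies the \<open>u\<close> that \<open>sharp_gmetric\<close> asks for.\<close>

lemma sharp_gmetric_props:
  assumes "\<eta> \<in> dual_M"
  shows "sharp (TM G z) (gmetric G z) \<eta> \<in> TM G z"
    and "Y \<in> TM G z \<Longrightarrow> gmetric G z Y (sharp (TM G z) (gmetric G z) \<eta>) = \<eta> Y"
proof -
  define p where "p = M.component \<eta>"
  define h where "h = \<eta> (vecM 1 0 0)"
  define k where "k = \<eta> (vecM 0 0 1)"
  have p: "p \<in> dual_Q"
    and \<eta>: "\<And>\<tau> v \<sigma>. v \<in> TQ G q \<Longrightarrow> \<eta> (vecM \<tau> v \<sigma>) = h * \<tau> + p v + k * \<sigma>"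
    unfolding p_def h_def k_def by (rule M.component_dual[OF assms], rule dual_M_expand[OF assms])
  define u where "u = sharp (TQ G q) aQ (p + k *\<^sub>R bQ)"
  have in_dual: "p + k *\<^sub>R bQ \<in> dual_Q" using p b_dual dual_space_add dual_space_scale by blast
  have u: "u \<in> TQ G q" "\<And>v. v \<in> TQ G q \<Longrightarrow> aQ v u = p v + k * bQ v"
    using a.sharp_in[OF in_dual] a.B_sharp[OF in_dual] by (simp_all add: u_def)
  note S = sharp_gmetric[OF u \<eta>]
  show "sharp (TM G z) (gmetric G z) \<eta> \<in> TM G z" using u by (simp add: S)
  assume "Y \<in> TM G z"
  then obtain \<tau> v \<sigma> where "v \<in> TQ G q" "Y = vecM \<tau> v \<sigma>" by (rule TM_E)
  then show "gmetric G z Y (sharp (TM G z) (gmetric G z) \<eta>) = \<eta> Y"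
    using u by (simp add: S gmetric_vec \<eta> algebra_simps)
qed

lemma gmetric_inv_eq:
  assumes "\<eta> \<in> dual_M" "\<theta> \<in> dual_M"
  shows "gmetric_inv G z \<eta> \<theta> = \<eta> (sharp (TM G z) (gmetric G z) \<theta>)"
  unfolding gmetric_inv_def inverse_form_def gmetric_sym[of "sharp _ _ \<eta>"]
  by (rule sharp_gmetric_props(2)[OF assms(1) sharp_gmetric_props(1)[OF assms(2)]])

section \<open>The Legendre transformation\<close>

text \<open>The inverse Legendre map, from momentum to velocity.\<close>

abbreviation "vel p \<equiv> sharp (TQ G q) aQ (p - bQ)"
abbreviation "L v \<equiv> Lagrangian G t q v"
abbreviation "H p \<equiv> Hamiltonian G t q p"

lemma vel_props:
  assumes "p \<in> dual_Q"
  shows vel_in: "vel p \<in> TQ G q"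
    and a_vel: "v \<in> TQ G q \<Longrightarrow> aQ v (vel p) = p v - bQ v"
    and Hamiltonian_eq: "H p = 1/2 * aQ (vel p) (vel p) + VQ"
proof -
  have d: "p - bQ \<in> dual_Q" using assms b_dual dual_space_diff by blast
  show "vel p \<in> TQ G q" "v \<in> TQ G q \<Longrightarrow> aQ v (vel p) = p v - bQ v"
    using a.sharp_in[OF d] a.B_sharp[OF d] by simp_all
  show "H p = 1/2 * aQ (vel p) (vel p) + VQ"
    by (simp add: Hamiltonian_def a_inv_def inverse_form_def)
qed

lemma sharp_cov:
  assumes "p \<in> dual_Q"
  shows "sharp (TM G z) (gmetric G z) (cov_M p h) = vecM (- 1) (- vel p) (2 * VQ - bQ (vel p) - h)"
proof -
  note v = vel_in[OF assms]
  have "sharp (TM G z) (gmetric G z) (cov_M p h) = vecM (- 1) (- vel p) (bQ (- vel p) + 2 * VQ * 1 - h)"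
    \<comment> \<open>The form has \<open>Q\<close>-part \<open>- p\<close> and coefficient 1 at
      \<open>\<sigma>\<close>, so \<open>u\<close> must represent \<open>-(p - b)\<close>: it is
      \<open>- vel p\<close>.\<close>
    using v by (intro sharp_gmetric[where p = "- p"])
      (simp_all add: dual_minus[OF a.B_dual] a_vel[OF assms])
  then show ?thesis by (simp add: dual_minus[OF b_dual v] algebra_simps)
qed

lemma cov_M_nonzero: "cov_M p h \<noteq> 0" if "p \<in> dual_Q"
proof
  assume "cov_M p h = 0"
  then have "cov_M p h (vecM 0 0 1) = 0" by simp
  then show False using that by (simp add: dual_zero)
qed

lemma lightlike_form_cov_iff:
  assumes "p \<in> dual_Q"
  shows "lightlike_form G z (cov_M p h) \<longleftrightarrow> h = H p"
proof -
  note v = vel_in[OF assms]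
  have "gmetric_inv G z (cov_M p h) (cov_M p h) = 2 * VQ - bQ (vel p) + p (vel p) - 2 * h"
    using v by (simp add: gmetric_inv_eq cov_dual assms sharp_cov dual_minus[OF assms])
  \<comment> \<open>\<open>p - b\<close> evaluated at \<open>vel p\<close> is the
    \<open>a\<close>-square of \<open>vel p\<close>, twice the kinetic part of
    \<open>H\<close>.\<close>
  also have "\<dots> = 2 * (H p - h)"
    using a_vel[OF assms v] by (simp add: Hamiltonian_eq[OF assms])
  finally show ?thesis
    using cov_dual[OF assms] cov_M_nonzero[OF assms] by (auto simp: lightlike_form_def)
qed

text \<open>Vectors tangent to the slice have \<open>\<tau> = 0\<close>, so the \<open>dt\<close>
  term disappears.\<close>

lemma restrict_cov:
  assumes "p \<in> dual_Q"
  shows "restrict_N G z (cov_M p h) = cov_N p"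
proof (rule ext)
  fix X
  show "restrict_N G z (cov_M p h) X = cov_N p X"
  proof (cases "X \<in> TN G t z")
    case True
    then obtain \<sigma> v where "v \<in> TQ G q" "X = vecN v \<sigma>" by (rule N.tangent_space_vecE)
    then show ?thesis by (simp add: pull_vec)
  next
    case False
    then show ?thesis
      using dual_off[OF cov_dual(2)[OF assms]] cov_dual(1)[OF assms] by (simp add: pull_off)
  qed
qed

text \<open>The restriction fixes \<open>\<eta>\<close> on all vectors with
  \<open>\<tau> = 0\<close>; only its value on \<open>\<partial>_t\<close> remains, and that is
  \<open>h\<close>.\<close>

lemma restrict_eq_covE:
  assumes p: "p \<in> dual_Q" and \<eta>: "\<eta> \<in> dual_M" and eq: "restrict_N G z \<eta> = cov_N p"
  obtains h where "\<eta> = cov_M p h"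
proof -
  define p' where "p' = M.component \<eta>"
  define h where "h = \<eta> (vecM 1 0 0)"
  define k where "k = \<eta> (vecM 0 0 1)"
  have \<eta>_vec: "\<eta> (vecM \<tau> v \<sigma>) = h * \<tau> + p' v + k * \<sigma>" if "v \<in> TQ G q" for \<tau> v \<sigma>
    unfolding p'_def h_def k_def by (rule dual_M_expand[OF \<eta> that])
  have *: "p' v + k * \<sigma> = \<sigma> - p v" if "v \<in> TQ G q" for v \<sigma>
    using fun_cong[OF eq, of "vecN v \<sigma>"] that by (simp add: pull_vec \<eta>_vec)
  have "\<eta> = cov_M p h"
  proof (rule dual_eqI[OF \<eta> cov_dual(1)[OF p]])
    fix X assume "X \<in> TM G z"
    then obtain \<tau> v \<sigma> where "v \<in> TQ G q" "X = vecM \<tau> v \<sigma>" by (rule TM_E)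
    then show "\<eta> X = cov_M p h X" using *[of v \<sigma>] by (simp add: \<eta>_vec)
  qed
  then show thesis by (rule that)
qed

lemma lightlike_form_iff:
  assumes p: "p \<in> dual_Q"
  shows "lightlike_form G z \<eta> \<and> restrict_N G z \<eta> = cov_N p \<longleftrightarrow> \<eta> = cov_M p (H p)"
proof
  assume \<eta>: "lightlike_form G z \<eta> \<and> restrict_N G z \<eta> = cov_N p"
  then obtain h where "\<eta> = cov_M p h"
    using restrict_eq_covE[OF p] unfolding lightlike_form_def by blast
  with \<eta> show "\<eta> = cov_M p (H p)" using lightlike_form_cov_iff[OF p] by simp
qed (simp add: lightlike_form_cov_iff restrict_cov p)

text \<open>The projection fixes \<open>\<tau> = 1\<close> and the \<open>Q\<close>-part, leaving
  only \<open>\<sigma>\<close> to be determined by the norm. Stated as an equivalence, this yields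
  existence and uniqueness at once.\<close>

lemma lightlike_iff:
  assumes v: "v \<in> TQ G q"
  shows "lightlike G z X \<and> push_E G z X = vecE 1 v \<longleftrightarrow> X = vecM 1 v (L v)"
proof
  have norm: "gmetric G z (vecM 1 v \<sigma>) (vecM 1 v \<sigma>) = 2 * (L v - \<sigma>)" for \<sigma>
    using v by (simp add: gmetric_vec Lagrangian_def algebra_simps)
  {
    assume X: "lightlike G z X \<and> push_E G z X = vecE 1 v"
    then have "X \<in> TM G z" by (simp add: lightlike_def)
    then obtain \<tau> u \<sigma> where u: "u \<in> TQ G q" and X_eq: "X = vecM \<tau> u \<sigma>" by (rule TM_E)
    with X v have "\<tau> = 1" "u = v" by (auto simp: pushforwards E.vec_eq_iff)
    with X show "X = vecM 1 v (L v)" by (simp add: X_eq lightlike_def norm)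
  }
  assume X: "X = vecM 1 v (L v)"
  have "vecM 1 v (L v) \<noteq> 0"
    using v M_vec_iff[of v 0 1 "L v" 0 0] M.vec_zero by (auto simp: zero_prod_def)
  with v show "lightlike G z X \<and> push_E G z X = vecE 1 v"
    by (simp add: X lightlike_def norm pushforwards)
qed

lemma time_orientation_eq: "time_orientation G z = vecM 1 0 (1/2 - VQ)"
  \<comment> \<open>\<open>M.vec_add\<close> combines sums only, so the subtraction is first made
    into the addition of a negative multiple.\<close>
  by (simp add: time_orientation_def velocity_flat M.vec_scale M.vec_add
      diff_conv_add_uminus scaleR_left.minus[symmetric] del: add_uminus_conv_diff)

text \<open>The potential and \<open>b\<close> cancel in the product with the time orientation,
  leaving \<open>-(1 + a(v, v))/2\<close>; the 1/2 in that field keeps it negative even for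
  \<open>v = 0\<close>.\<close>

lemma future_directed_lift:
  assumes v: "v \<in> TQ G q"
  shows "future_directed G z (vecM 1 v (L v))"
proof -
  have "lightlike G z (vecM 1 v (L v))" using lightlike_iff[OF v] by blast
  moreover have "gmetric G z (vecM 1 v (L v)) (time_orientation G z) = - 1/2 - 1/2 * aQ v v"
    using v by (simp add: time_orientation_eq gmetric_vec dual_zero[OF b_dual] Lagrangian_def)
  ultimately show ?thesis
    using a.B_nonneg[OF v] by (simp add: future_directed_def lightlike_def)
qed

lemma TE_E:
  assumes "w \<in> TE G (t, q)" "dt_E G (t, q) w = 1"
  obtains v where "v \<in> TQ G q" "w = vecE 1 v"
  using E.tangent_space_vecE[OF assms(1)] assms(2) by (metis flat_forms(1))

text \<open>\<open>vel\<close> inverts the Legendre map: both sides represent the same form under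
  \<open>a\<close>.\<close>

lemma momentum_props:
  assumes v: "v \<in> TQ G q"
  shows "(\<lambda>u. aQ u v + bQ u) \<in> dual_Q"
    and "vel (\<lambda>u. aQ u v + bQ u) = v"
proof -
  have eq: "(\<lambda>u. aQ u v + bQ u) = aQ v + bQ"
    by (simp add: fun_eq_iff a.B_sym)
  show p: "(\<lambda>u. aQ u v + bQ u) \<in> dual_Q"
    unfolding eq using a.B_dual b_dual by (rule dual_space_add)
  show "vel (\<lambda>u. aQ u v + bQ u) = v"
    by (rule a.B_nondegenerate[OF vel_in[OF p] v]) (simp add: a_vel[OF p])
qed

lemma flat_lift:
  assumes v: "v \<in> TQ G q"
  defines "p \<equiv> \<lambda>u. aQ u v + bQ u"
  shows "(\<lambda>X. - gmetric G z X (vecM 1 v (L v))) = cov_M p (H p)"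
proof
  fix X
  have p: "p \<in> dual_Q" and vel: "vel p = v"
    using momentum_props[OF v] by (simp_all add: p_def)
  show "- gmetric G z X (vecM 1 v (L v)) = cov_M p (H p) X"
  proof (cases "X \<in> TM G z")
    case True
    then obtain \<tau> u \<sigma> where "u \<in> TQ G q" "X = vecM \<tau> u \<sigma>" by (rule TM_E)
    then show ?thesis
      \<comment> \<open>\<open>p\<close> stays folded at first, so that
        \<open>Hamiltonian_eq\<close> and \<open>vel\<close> can match. The \<open>dt\<close>
        coefficient is then \<open>L - b v + 2 V\<close>, which is \<open>H\<close>.\<close>
      using v by (simp add: gmetric_vec Hamiltonian_eq[OF p] vel Lagrangian_def algebra_simps)
        (simp add: p_def)
  next
    case False
    then show ?thesis
      using dual_off[OF cov_dual(1)[OF p]] by (simp add: gmetric_off)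
  qed
qed

text \<open>For \<open>h = H p\<close> the dual vector is minus the lift of \<open>vel p\<close>,
  and the sign in the statement cancels it.\<close>

lemma sharp_cov_Hamiltonian:
  assumes p: "p \<in> dual_Q"
  shows "bidual_eq (TM G z) (\<lambda>\<eta>. - gmetric_inv G z \<eta> (cov_M p (H p))) (vecM 1 (vel p) (L (vel p)))"
  unfolding bidual_eq_def
proof
  note v = vel_in[OF p]
  show in_TM: "vecM 1 (vel p) (L (vel p)) \<in> TM G z" using v by simp
  have "sharp (TM G z) (gmetric G z) (cov_M p (H p)) = (- 1) *\<^sub>R vecM 1 (vel p) (L (vel p))"
    unfolding M.vec_scale by (simp add: sharp_cov[OF p] Hamiltonian_eq[OF p] Lagrangian_def algebra_simps)
  then show "\<forall>\<eta>\<in>dual_M. \<eta> (vecM 1 (vel p) (L (vel p))) = - gmetric_inv G z \<eta> (cov_M p (H p))"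
    using in_TM by (simp add: gmetric_inv_eq cov_dual[OF p] dual_scale dual_minus)
qed

end

text \<open>The explicit formulas are stated for every admissible decomposition and every lightlike
  solution; the unique existence clauses beside them make these statements non-vacuous.\<close>

theorem theorem1p3:
  fixes G :: "('q, 'e::real_normed_vector) ggw"
    and r d :: nat and t y :: real and q :: 'q
  assumes "r \<ge> 2" and "ggw_spacetime r d G"
    and "t \<in> T_of G" and "q \<in> topspace (Q_top G)"
  shows
    "(\<forall>w\<in>TE G (t, q). dt_E G (t, q) w = 1 \<longrightarrow>
        (\<exists>!v. v \<in> TQ G q \<and> w = del_t_E G (t, q) + lift_E G (t, q) v) \<and>
        (\<exists>!X. lightlike G (t, q, y) X \<and> push_E G (t, q, y) X = w) \<and>
        (\<forall>v\<in>TQ G q. w = del_t_E G (t, q) + lift_E G (t, q) v \<longrightarrow>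
          (\<forall>X. lightlike G (t, q, y) X \<and> push_E G (t, q, y) X = w \<longrightarrow>
             future_directed G (t, q, y) X \<and>
             X = del_t G (t, q, y) + lift_M G (t, q, y) v
                   + Lagrangian G t q v *\<^sub>R n_vec G (t, q, y))))
     \<and>
     (\<forall>\<omega>\<in>dual_space (TN G t (t, q, y)). \<omega> (n_vec_N G (t, q, y)) = 1 \<longrightarrow>
        (\<exists>!p. p \<in> dual_space (TQ G q) \<and> \<omega> = dy_N G (t, q, y) - pull_N G (t, q, y) p) \<and>
        (\<exists>!\<eta>. lightlike_form G (t, q, y) \<eta> \<and> restrict_N G (t, q, y) \<eta> = \<omega>) \<and>
        (\<forall>p\<in>dual_space (TQ G q). \<omega> = dy_N G (t, q, y) - pull_N G (t, q, y) p \<longrightarrow>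
          (\<forall>\<eta>. lightlike_form G (t, q, y) \<eta> \<and> restrict_N G (t, q, y) \<eta> = \<omega> \<longrightarrow>
             \<eta> = dy G (t, q, y) - pull_M G (t, q, y) p
                   + Hamiltonian G t q p *\<^sub>R dt G (t, q, y))))
     \<and>
     (\<forall>v\<in>TQ G q. let p = (\<lambda>u. a_of G t q u v + b_of G t q u) in
        p \<in> dual_space (TQ G q) \<and>
        fibre_derivative (TQ G q) (Lagrangian G t q) v p \<and>
        (\<lambda>X. - gmetric G (t, q, y) X
                 (del_t G (t, q, y) + lift_M G (t, q, y) v
                   + Lagrangian G t q v *\<^sub>R n_vec G (t, q, y)))
          = dy G (t, q, y) - pull_M G (t, q, y) p
              + Hamiltonian G t q p *\<^sub>R dt G (t, q, y))
     \<and>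
     (\<forall>p\<in>dual_space (TQ G q).
        \<exists>!v. bidual_eq (TQ G q) (\<lambda>\<sigma>. a_inv G t q \<sigma> (p - b_of G t q)) v)
     \<and>
     (\<forall>p\<in>dual_space (TQ G q). \<forall>v.
        bidual_eq (TQ G q) (\<lambda>\<sigma>. a_inv G t q \<sigma> (p - b_of G t q)) v \<longrightarrow>
        fibre_derivative (dual_space (TQ G q)) (Hamiltonian G t q) p (\<lambda>\<sigma>. \<sigma> v) \<and>
        bidual_eq (TM G (t, q, y))
          (\<lambda>\<eta>. - gmetric_inv G (t, q, y) \<eta>
                   (dy G (t, q, y) - pull_M G (t, q, y) p
                     + Hamiltonian G t q p *\<^sub>R dt G (t, q, y)))
          (del_t G (t, q, y) + lift_M G (t, q, y) v
             + Lagrangian G t q v *\<^sub>R n_vec G (t, q, y)))"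
proof -
  interpret ggw_point G r d t y q
    using assms by unfold_locales
  \<comment> \<open>From here on both lifts are triples or pairs, and the claims become instances of
    the equivalences above.\<close>
  have lift: "del_t G z + lift_M G z v + L v *\<^sub>R n_vec G z = vecM 1 v (L v)"
    if "v \<in> TQ G q" for v
    using that by (simp add: velocity_flat lift_eq M.vec_add M.vec_scale)
  have lift_E: "del_t_E G (t, q) + lift_E G (t, q) v = vecE 1 v" if "v \<in> TQ G q" for v
    using that by (simp add: velocity_flat lift_eq E.vec_add)
  note cov = cov_M_def[symmetric] cov_N_def[symmetric]
  show ?thesis
    unfolding cov Let_def
  proof (intro conjI ballI impI allI)
    fix w assume w: "w \<in> TE G (t, q)" "dt_E G (t, q) w = 1"
    then obtain v where v: "v \<in> TQ G q" "w = vecE 1 v" by (rule TE_E)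
    show "\<exists>!v. v \<in> TQ G q \<and> w = del_t_E G (t, q) + lift_E G (t, q) v"
      using v by (intro ex1I[of _ v]) (auto simp: lift_E E.vec_eq_iff)
    show "\<exists>!X. lightlike G z X \<and> push_E G z X = w"
      \<comment> \<open>The equivalence turns the claim into the unique existence of an
        \<open>X\<close> equal to a given vector.\<close>
      unfolding v(2) lightlike_iff[OF v(1)] by simp
    fix v' X assume v': "v' \<in> TQ G q" "w = del_t_E G (t, q) + lift_E G (t, q) v'"
      and X: "lightlike G z X \<and> push_E G z X = w"
    from X have "X = vecM 1 v' (L v')"
      unfolding v'(2) lift_E[OF v'(1)] lightlike_iff[OF v'(1)] .
    then show "future_directed G z X" "X = del_t G z + lift_M G z v' + L v' *\<^sub>R n_vec G z"
      using future_directed_lift[OF v'(1)] lift[OF v'(1)] by simp_all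
  next
    fix \<omega> assume "\<omega> \<in> dual_N" "\<omega> (n_vec_N G z) = 1"
    then obtain p where p: "p \<in> dual_Q" "\<omega> = cov_N p" by (rule cov_N_E)
    show "\<exists>!p. p \<in> dual_Q \<and> \<omega> = cov_N p"
      using p by (intro ex1I[of _ p]) (auto simp: cov_N_eq_iff)
    show "\<exists>!\<eta>. lightlike_form G z \<eta> \<and> restrict_N G z \<eta> = \<omega>"
      unfolding p(2) lightlike_form_iff[OF p(1)] by simp
    fix p' \<eta> assume p': "p' \<in> dual_Q" "\<omega> = cov_N p'"
      and "lightlike_form G z \<eta> \<and> restrict_N G z \<eta> = \<omega>"
    then show "\<eta> = cov_M p' (H p')"
      using lightlike_form_iff[OF p'(1)] by simp
  next
    fix v assume v: "v \<in> TQ G q"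
    show "(\<lambda>u. aQ u v + bQ u) \<in> dual_Q" by (rule momentum_props(1)[OF v])
    show "fibre_derivative (TQ G q) (Lagrangian G t q) v (\<lambda>u. aQ u v + bQ u)"
      unfolding Lagrangian_def[abs_def] by (rule a.fibre_derivative_quadratic[OF b_dual v])
    show "(\<lambda>X. - gmetric G z X (del_t G z + lift_M G z v + L v *\<^sub>R n_vec G z))
        = cov_M (\<lambda>u. aQ u v + bQ u) (H (\<lambda>u. aQ u v + bQ u))"
      unfolding lift[OF v] by (rule flat_lift[OF v])
  next
    fix p assume p: "p \<in> dual_Q"
    have vel: "bidual_eq (TQ G q) (\<lambda>\<sigma>. a_inv G t q \<sigma> (p - bQ)) v \<longleftrightarrow> v = vel p" for v
      unfolding a_inv_def using p b_dual by (intro a.bidual_eq_inverse_form dual_space_diff)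
    show "\<exists>!v. bidual_eq (TQ G q) (\<lambda>\<sigma>. a_inv G t q \<sigma> (p - bQ)) v"
      by (simp add: vel)
    fix v assume "bidual_eq (TQ G q) (\<lambda>\<sigma>. a_inv G t q \<sigma> (p - bQ)) v"
    then have v: "v = vel p" by (simp add: vel)
    show "fibre_derivative dual_Q (Hamiltonian G t q) p (\<lambda>\<sigma>. \<sigma> v)"
      unfolding v Hamiltonian_def[abs_def] a_inv_def
      by (rule a.fibre_derivative_inverse_quadratic[OF p b_dual])
    show "bidual_eq (TM G z) (\<lambda>\<eta>. - gmetric_inv G z \<eta> (cov_M p (H p)))
        (del_t G z + lift_M G z v + L v *\<^sub>R n_vec G z)"
      unfolding v lift[OF vel_in[OF p]] by (rule sharp_cov_Hamiltonian[OF p])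
  qed
qed

end
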